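(* Let $\phi:Q\to M$ be a principal $G$-bundle, $R$ a $G$-equivariant smooth retraction on $Q$, and $\mathcal{A}$ a connection $1$-form on $\phi$. Let $h$ be the horizontal lift of $\mathcal{A}$, and let $\check R$, $\widetilde{\check R}$, $\mathcal{U}:=(\phi\times\phi)^{-1}(W_{\check R})$, $\mathcal{U}':=(\mathrm{id}_Q\times\phi)(\mathcal{U})$ and the discrete horizontal lift $$h_d:\mathcal{U}'\to Q\times Q,\qquad h_d(q,m):=\widetilde{R}\big(h(q,\widetilde{\check R}^{-1}(\phi(q),m))\big)$$ be as defined in the context. Let $\mathcal{A}_d:\mathcal{U}\to G$ be the discrete connection form corresponding to $h_d$. Then $\mathcal{A}_d$ integrates $\mathcal{A}$, that is, $F_C(\mathcal{A}_d)=\mathcal{A}$.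
   Context: $G$ is a Lie group with Lie algebra $\mathfrak{g}$; $\phi:Q\to M$ is a smooth principal bundle for a left action of $G$ on $Q$, with $g\in G$ acting by $l^Q_g$, and $l^{TQ}_g:=Tl^Q_g$. For $\xi\in\mathfrak{g}$, $\xi_Q(q):=\frac{d}{dt}\big|_{t=0}l^Q_{\exp(t\xi)}(q)$. Connections. A connection $1$-form on $\phi$ is a smooth $\mathfrak{g}$-valued $1$-form $\mathcal{A}:TQ\to\mathfrak{g}$ with $\mathcal{A}(\xi_Q(q))=\xi$ and $\mathcal{A}(l^{TQ}_g(v))=\mathrm{Ad}_g(\mathcal{A}(v))$. Its horizontal lift is $h:\phi^*TM\to TQ$, $h(q,\delta m):=\delta q-(\mathcal{A}(\delta q))_Q(q)$ for any $\delta q\in T_qQ$ with $T_q\phi(\delta q)=\delta m$. Discrete connections. An open subset $\mathcal{U}\subset Q\times Q$ is of $D$-type if it is $G\times G$-invariant and contains the diagonal $\Delta_Q$; put $\mathcal{U}':=(\mathrm{id}_Q\times\phi)(\mathcal{U})\subset Q\times M$. A discrete connection form with domain $\mathcal{U}$ is a smooth $\mathcal{A}_d:\mathcal{U}\to G$ with $\mathcal{A}_d(q,q)=e$ and $\mathcal{A}_d(l^Q_g(q),l^Q_{g'}(q'))=g'\mathcal{A}_d(q,q')g^{-1}$. A discrete horizontal lift with domain $\mathcal{U}'$ is a smooth $h_d:\mathcal{U}'\to Q\times Q$ such that $h_d(l^Q_g(q),m)=(l^Q_g\times l^Q_g)(h_d(q,m))$, $(\mathrm{id}_Q\times\phi)\circ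 h_d=\mathrm{id}_{\mathcal{U}'}$ and $h_d(q,\phi(q))=(q,q)$. Discrete connection forms on $\mathcal{U}$ correspond bijectively to discrete horizontal lifts on $\mathcal{U}'$ by $h_d(q,m)=(q,l^Q_{\mathcal{A}_d(q,q')^{-1}}(q'))$ for any $q'\in\phi^{-1}(m)$. The derived connection is $F_C(\mathcal{A}_d)(v_q):=D_2\mathcal{A}_d(q,q)(v_q)=T_{(q,q)}\mathcal{A}_d(0,v_q)$. Retractions. A smooth retraction on a manifold $X$ is a smooth map $R:\mathcal{Z}\to X$, with $\mathcal{Z}\subset TX$ an open neighborhood of the image $Z_X$ of the zero section, such that, with $R_x:=R|_{T_xX\cap\mathcal{Z}}$, $R_x(0_x)=x$ and $T_{0_x}R_x=\mathrm{id}_{T_xX}$ (identifying $T_{0_x}T_xX\simeq T_xX$) for all $x\in X$. Its extended retraction is $\widetilde{R}:\mathcal{Z}\to X\times X$, $\widetilde{R}(v_x):=(x,R(v_x))$. There are open sets $V_R\subset TX$, $W_R\subset X\times X$ containing $Z_X$ and $\Delta_X$ such that $\widetilde{R}:V_R\to W_R$ is a diffeomorphism; such sets are fixed and $\widetilde{R}^{-1}:W_R\to V_R$ denotes the inverse of this restriction. A smooth retraction $R:\mathcal{Z}\to Q$ on $Q$ is $G$-equivariant if $\mathcal{Z}$ is invariant under $l^{TQ}$ and $R\circ l^{TQ}_g=l^Q_g\circ R$ for all $g\in G$. Reduced retraction. Given a $G$-equivariant smooth retraction $R:\mathcal{Z}\to Q$ and the horizontal lift $h$, the map $\check R$, defined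 by $\check R(\delta m):=\phi(R(h(q,\delta m)))$ for $\delta m\in T_mM$, any $q\in\phi^{-1}(m)$, whenever $h(q,\delta m)\in\mathcal{Z}$, is a smooth retraction on $M$. Its extended retraction is $\widetilde{\check R}(\delta m):=(m,\check R(\delta m))$ for $\delta m\in T_mM$ in the domain of $\check R$; open sets $V_{\check R}\subset TM$ (contained in the domain of $\check R$) and $W_{\check R}\subset M\times M$, containing the image $Z_M$ of the zero section and the diagonal $\Delta_M$ respectively, are fixed such that $\widetilde{\check R}:V_{\check R}\to W_{\check R}$ is a diffeomorphism, and $\widetilde{\check R}^{-1}:W_{\check R}\to V_{\check R}$ denotes the inverse of this restriction. *)

theory Defs
  imports "HOL-Analysis.Analysis" "HOL-Algebra.Group_Action"
begin

section \<open>Smooth maps between open subsets of normed spaces\<close>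

text \<open>
  The sets \<open>S\<close> are meant to be open and the spaces finite-dimensional: there a map is of class
  \<open>C\<close> with exponent \<open>k + 1\<close> iff it is differentiable and all its directional derivatives are of
  class \<open>C\<close> with exponent \<open>k\<close>.
\<close>

primrec Ck_on :: "nat \<Rightarrow> 'a::real_normed_vector set \<Rightarrow> ('a \<Rightarrow> 'b::real_normed_vector) \<Rightarrow> bool" where
  "Ck_on 0 S f \<longleftrightarrow> continuous_on S f"
| "Ck_on (Suc k) S f \<longleftrightarrow>
     (\<forall>x\<in>S. f differentiable (at x)) \<and> (\<forall>v. Ck_on k S (\<lambda>x. frechet_derivative f (at x) v))"

definition smooth_on :: "'a::real_normed_vector set \<Rightarrow> ('a \<Rightarrow> 'b::real_normed_vector) \<Rightarrow> bool" where
  "smooth_on S f \<longleftrightarrow> (\<forall>k. Ck_on k S f)"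


section \<open>Smooth manifolds\<close>

text \<open>
  A chart is a pair of its domain and its coordinate map; only the values of the coordinate map on
  the domain matter. A manifold is given by an atlas, which need not be maximal. The model space is a
  normed space of finite dimension rather than a Euclidean space because the class
  \<open>euclidean_space\<close> excludes dimension 0, that is, discrete groups and one-point base manifolds.
\<close>

type_synonym ('a, 'e) chart = "'a set \<times> ('a \<Rightarrow> 'e)"
type_synonym ('a, 'e) atlas = "('a, 'e) chart set"

definition chart_inv :: "('a, 'e) chart \<Rightarrow> 'e \<Rightarrow> 'a" where
  "chart_inv c = inv_into (fst c) (snd c)"

definition mcarrier :: "('a, 'e) atlas \<Rightarrow> 'a set" where
  "mcarrier A = (\<Union>c\<in>A. fst c)"

definition charts_at :: "('a, 'e) atlas \<Rightarrow> 'a \<Rightarrow> ('a, 'e) atlas" where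
  "charts_at A p = {c \<in> A. p \<in> fst c}"

definition smooth_atlas :: "('a, 'e::real_normed_vector) atlas \<Rightarrow> bool" where
  "smooth_atlas A \<longleftrightarrow>
     (\<forall>c\<in>A. inj_on (snd c) (fst c)) \<and>
     (\<forall>c\<in>A. \<forall>d\<in>A. open (snd c ` (fst c \<inter> fst d)) \<and>
        smooth_on (snd c ` (fst c \<inter> fst d)) (snd d \<circ> chart_inv c))"

definition mtop :: "('a, 'e::real_normed_vector) atlas \<Rightarrow> 'a topology" where
  "mtop A = topology (\<lambda>W. W \<subseteq> mcarrier A \<and> (\<forall>c\<in>A. open (snd c ` (fst c \<inter> W))))"

lemma openin_mtop:
  assumes "smooth_atlas A"
  shows "openin (mtop A) W \<longleftrightarrow> W \<subseteq> mcarrier A \<and> (\<forall>c\<in>A. open (snd c ` (fst c \<inter> W)))"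
proof -
  have "istopology (\<lambda>W. W \<subseteq> mcarrier A \<and> (\<forall>c\<in>A. open (snd c ` (fst c \<inter> W))))"
    unfolding istopology_def
  proof (intro conjI allI impI; (elim conjE)?)
    fix S T assume S: "\<forall>c\<in>A. open (snd c ` (fst c \<inter> S))" and T: "\<forall>c\<in>A. open (snd c ` (fst c \<inter> T))"
    have "snd c ` (fst c \<inter> (S \<inter> T)) = snd c ` (fst c \<inter> S) \<inter> snd c ` (fst c \<inter> T)" if "c \<in> A" for c
      using assms that unfolding smooth_atlas_def by (auto simp: inj_on_def)
    then show "\<forall>c\<in>A. open (snd c ` (fst c \<inter> (S \<inter> T)))"
      using S T by (simp add: open_Int)
  next
    fix \<K> assume K: "\<forall>K\<in>\<K>. K \<subseteq> mcarrier A \<and> (\<forall>c\<in>A. open (snd c ` (fst c \<inter> K)))"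
    have "snd c ` (fst c \<inter> \<Union>\<K>) = (\<Union>K\<in>\<K>. snd c ` (fst c \<inter> K))" for c :: "('a, 'b) chart"
      by auto
    then show "\<forall>c\<in>A. open (snd c ` (fst c \<inter> \<Union>\<K>))"
      using K by (metis (no_types, lifting) open_UN)
  qed auto
  then show ?thesis
    by (simp add: mtop_def topology_inverse')
qed

lemma topspace_mtop:
  assumes "smooth_atlas A"
  shows "topspace (mtop A) = mcarrier A"
proof -
  have *: "fst c \<inter> mcarrier A = fst c" if "c \<in> A" for c
    using that by (auto simp: mcarrier_def)
  have "open (snd c ` fst c)" if "c \<in> A" for c
    using assms that unfolding smooth_atlas_def by (metis Int_absorb)
  then have "openin (mtop A) (mcarrier A)"
    by (auto simp: openin_mtop[OF assms] *)
  then show ?thesis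
    by (meson assms openin_mtop openin_subset openin_topspace subset_antisym)
qed

definition smooth_manifold :: "('a, 'e::real_normed_vector) atlas \<Rightarrow> bool" where
  "smooth_manifold A \<longleftrightarrow>
     smooth_atlas A \<and>
     (\<exists>B::'e set. finite B \<and> span B = UNIV) \<and>
     Hausdorff_space (mtop A) \<and>
     (\<exists>\<B>. countable \<B> \<and> openin (mtop A) = arbitrary union_of (\<lambda>W. W \<in> \<B>))"

text \<open>Smoothness of a map defined on an open subset \<open>S\<close> of a manifold.\<close>

definition smooth_map ::
  "('a, 'e::real_normed_vector) atlas \<Rightarrow> 'a set \<Rightarrow> ('b, 'f::real_normed_vector) atlas \<Rightarrow> ('a \<Rightarrow> 'b) \<Rightarrow> bool"
where
  "smooth_map A S B f \<longleftrightarrow>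
     openin (mtop A) S \<and>
     continuous_map (subtopology (mtop A) S) (mtop B) f \<and>
     (\<forall>c\<in>A. \<forall>d\<in>B. smooth_on (snd c ` (fst c \<inter> S \<inter> f -` fst d)) (snd d \<circ> f \<circ> chart_inv c))"

definition diffeo ::
  "('a, 'e::real_normed_vector) atlas \<Rightarrow> 'a set \<Rightarrow> ('b, 'f::real_normed_vector) atlas \<Rightarrow> 'b set \<Rightarrow> ('a \<Rightarrow> 'b) \<Rightarrow> bool"
where
  "diffeo A S B T f \<longleftrightarrow>
     bij_betw f S T \<and> smooth_map A S B f \<and> smooth_map B T A (inv_into S f)"

definition prod_atlas :: "('a, 'e) atlas \<Rightarrow> ('b, 'f) atlas \<Rightarrow> ('a \<times> 'b, 'e \<times> 'f) atlas" where
  "prod_atlas A B = (\<lambda>(c, d). (fst c \<times> fst d, map_prod (snd c) (snd d))) ` (A \<times> B)"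

definition real_atlas :: "(real, real) atlas" where
  "real_atlas = {(UNIV, \<lambda>t. t)}"


section \<open>Tangent bundle\<close>

text \<open>
  A tangent vector at \<open>p\<close> is \<open>p\<close> together with its coordinate vectors in all charts around
  \<open>p\<close>, which are related by the derivatives of the chart transitions; for all other charts the
  family is 0, which makes the representation unique.
\<close>

type_synonym ('a, 'e) tangent = "'a \<times> (('a, 'e) chart \<Rightarrow> 'e)"

definition tspace :: "('a, 'e::real_normed_vector) atlas \<Rightarrow> 'a \<Rightarrow> ('a, 'e) tangent set" where
  "tspace A p = {w. fst w = p \<and>
     (\<forall>c. c \<notin> charts_at A p \<longrightarrow> snd w c = 0) \<and>
     (\<forall>c\<in>charts_at A p. \<forall>d\<in>charts_at A p.
        snd w d = frechet_derivative (snd d \<circ> chart_inv c) (at (snd c p)) (snd w c))}"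

definition tcarrier :: "('a, 'e::real_normed_vector) atlas \<Rightarrow> ('a, 'e) tangent set" where
  "tcarrier A = (\<Union>p\<in>mcarrier A. tspace A p)"

definition tzero :: "'a \<Rightarrow> ('a, 'e::real_normed_vector) tangent" where
  "tzero p = (p, \<lambda>c. 0)"

text \<open>The first two operations are meant for tangent vectors with the same base point.\<close>

definition tadd :: "('a, 'e::real_normed_vector) tangent \<Rightarrow> ('a, 'e) tangent \<Rightarrow> ('a, 'e) tangent" where
  "tadd v w = (fst v, \<lambda>c. snd v c + snd w c)"

definition tdiff :: "('a, 'e::real_normed_vector) tangent \<Rightarrow> ('a, 'e) tangent \<Rightarrow> ('a, 'e) tangent" where
  "tdiff v w = (fst v, \<lambda>c. snd v c - snd w c)"

definition tscale :: "real \<Rightarrow> ('a, 'e::real_normed_vector) tangent \<Rightarrow> ('a, 'e) tangent" where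
  "tscale r v = (fst v, \<lambda>c. r *\<^sub>R snd v c)"

text \<open>The manifold structure of \<open>TX\<close>, and that of the vector space \<open>T\<^sub>p X\<close>.\<close>

definition tbundle :: "('a, 'e::real_normed_vector) atlas \<Rightarrow> (('a, 'e) tangent, 'e \<times> 'e) atlas" where
  "tbundle A = (\<lambda>c. ({w \<in> tcarrier A. fst w \<in> fst c}, \<lambda>w. (snd c (fst w), snd w c))) ` A"

definition tspace_atlas :: "('a, 'e::real_normed_vector) atlas \<Rightarrow> 'a \<Rightarrow> (('a, 'e) tangent, 'e) atlas" where
  "tspace_atlas A p = (\<lambda>c. (tspace A p, \<lambda>w. snd w c)) ` charts_at A p"

text \<open>
  The tangent map \<open>Tf\<close> of a map \<open>f\<close> that is defined and smooth near the base point; the result does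
  not depend on the chosen chart around the base point.
\<close>

definition tmap ::
  "('a, 'e::real_normed_vector) atlas \<Rightarrow> ('b, 'f::real_normed_vector) atlas \<Rightarrow> ('a \<Rightarrow> 'b) \<Rightarrow>
   ('a, 'e) tangent \<Rightarrow> ('b, 'f) tangent"
where
  "tmap A B f v = (f (fst v), \<lambda>d.
     if d \<in> charts_at B (f (fst v))
     then let c = (SOME c. c \<in> charts_at A (fst v))
          in frechet_derivative (snd d \<circ> f \<circ> chart_inv c) (at (snd c (fst v))) (snd v c)
     else 0)"

definition velocity ::
  "('a, 'e::real_normed_vector) atlas \<Rightarrow> (real \<Rightarrow> 'a) \<Rightarrow> real \<Rightarrow> ('a, 'e) tangent" where
  "velocity A \<gamma> t = (\<gamma> t, \<lambda>c.
     if c \<in> charts_at A (\<gamma> t) then vector_derivative (snd c \<circ> \<gamma>) (at t) else 0)"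


section \<open>Lie groups and principal bundles\<close>

definition lie_group :: "('g, 'x) monoid_scheme \<Rightarrow> ('g, 'k::real_normed_vector) atlas \<Rightarrow> bool" where
  "lie_group G AG \<longleftrightarrow>
     group G \<and> smooth_manifold AG \<and> mcarrier AG = carrier G \<and>
     smooth_map (prod_atlas AG AG) (carrier G \<times> carrier G) AG (\<lambda>(a, b). a \<otimes>\<^bsub>G\<^esub> b) \<and>
     smooth_map AG (carrier G) AG (\<lambda>a. inv\<^bsub>G\<^esub> a)"

definition lie_algebra ::
  "('g, 'x) monoid_scheme \<Rightarrow> ('g, 'k::real_normed_vector) atlas \<Rightarrow> ('g, 'k) tangent set" where
  "lie_algebra G AG = tspace AG \<one>\<^bsub>G\<^esub>"

definition lie_Ad ::
  "('g, 'x) monoid_scheme \<Rightarrow> ('g, 'k::real_normed_vector) atlas \<Rightarrow> 'g \<Rightarrow>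
   ('g, 'k) tangent \<Rightarrow> ('g, 'k) tangent" where
  "lie_Ad G AG g = tmap AG AG (\<lambda>a. g \<otimes>\<^bsub>G\<^esub> a \<otimes>\<^bsub>G\<^esub> inv\<^bsub>G\<^esub> g)"

definition one_parameter_subgroup ::
  "('g, 'x) monoid_scheme \<Rightarrow> ('g, 'k::real_normed_vector) atlas \<Rightarrow> (real \<Rightarrow> 'g) \<Rightarrow> bool" where
  "one_parameter_subgroup G AG \<gamma> \<longleftrightarrow>
     smooth_map real_atlas UNIV AG \<gamma> \<and> (\<forall>s t. \<gamma> (s + t) = \<gamma> s \<otimes>\<^bsub>G\<^esub> \<gamma> t)"

definition lie_exp ::
  "('g, 'x) monoid_scheme \<Rightarrow> ('g, 'k::real_normed_vector) atlas \<Rightarrow> ('g, 'k) tangent \<Rightarrow> 'g" where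
  "lie_exp G AG \<xi> = (THE \<gamma>. one_parameter_subgroup G AG \<gamma> \<and> velocity AG \<gamma> 0 = \<xi>) 1"

text \<open>The infinitesimal generator \<open>\<xi>\<^sub>Q\<close>.\<close>

definition inf_gen ::
  "('g, 'x) monoid_scheme \<Rightarrow> ('g, 'k::real_normed_vector) atlas \<Rightarrow>
   ('q, 'e::real_normed_vector) atlas \<Rightarrow> ('g \<Rightarrow> 'q \<Rightarrow> 'q) \<Rightarrow>
   ('g, 'k) tangent \<Rightarrow> 'q \<Rightarrow> ('q, 'e) tangent" where
  "inf_gen G AG AQ l \<xi> q = velocity AQ (\<lambda>t. l (lie_exp G AG (tscale t \<xi>)) q) 0"

text \<open>
  The action \<open>l\<close> is a homomorphism into the group of bijections of the carrier, hence a left action.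
  Local trivializations intertwine it with left multiplication on the second factor; this makes it
  free, with the fibres of \<open>\<phi>\<close> as its orbits.
\<close>

definition principal_bundle ::
  "('g, 'x) monoid_scheme \<Rightarrow> ('g, 'k::real_normed_vector) atlas \<Rightarrow>
   ('q, 'e::real_normed_vector) atlas \<Rightarrow> ('m, 'f::real_normed_vector) atlas \<Rightarrow>
   ('g \<Rightarrow> 'q \<Rightarrow> 'q) \<Rightarrow> ('q \<Rightarrow> 'm) \<Rightarrow> bool" where
  "principal_bundle G AG AQ AM l \<phi> \<longleftrightarrow>
     lie_group G AG \<and> smooth_manifold AQ \<and> smooth_manifold AM \<and>
     group_action G (mcarrier AQ) l \<and>
     smooth_map (prod_atlas AG AQ) (carrier G \<times> mcarrier AQ) AQ (\<lambda>(g, q). l g q) \<and>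
     smooth_map AQ (mcarrier AQ) AM \<phi> \<and>
     (\<forall>m\<in>mcarrier AM. \<exists>V \<Psi>. openin (mtop AM) V \<and> m \<in> V \<and>
        diffeo AQ {q \<in> mcarrier AQ. \<phi> q \<in> V} (prod_atlas AM AG) (V \<times> carrier G) \<Psi> \<and>
        (\<forall>q\<in>mcarrier AQ. \<phi> q \<in> V \<longrightarrow> fst (\<Psi> q) = \<phi> q \<and>
           (\<forall>g\<in>carrier G. \<Psi> (l g q) = (\<phi> q, g \<otimes>\<^bsub>G\<^esub> snd (\<Psi> q)))))"


section \<open>Connections\<close>

definition connection_form ::
  "('g, 'x) monoid_scheme \<Rightarrow> ('g, 'k::real_normed_vector) atlas \<Rightarrow>
   ('q, 'e::real_normed_vector) atlas \<Rightarrow> ('g \<Rightarrow> 'q \<Rightarrow> 'q) \<Rightarrow>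
   (('q, 'e) tangent \<Rightarrow> ('g, 'k) tangent) \<Rightarrow> bool" where
  "connection_form G AG AQ l \<A> \<longleftrightarrow>
     smooth_map (tbundle AQ) (tcarrier AQ) (tspace_atlas AG \<one>\<^bsub>G\<^esub>) \<A> \<and>
     (\<forall>q\<in>mcarrier AQ. \<forall>v\<in>tspace AQ q. \<forall>w\<in>tspace AQ q. \<forall>r.
        \<A> (tadd v w) = tadd (\<A> v) (\<A> w) \<and> \<A> (tscale r v) = tscale r (\<A> v)) \<and>
     (\<forall>\<xi>\<in>lie_algebra G AG. \<forall>q\<in>mcarrier AQ. \<A> (inf_gen G AG AQ l \<xi> q) = \<xi>) \<and>
     (\<forall>g\<in>carrier G. \<forall>v\<in>tcarrier AQ. \<A> (tmap AQ AQ (l g) v) = lie_Ad G AG g (\<A> v))"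

text \<open>
  The horizontal lift of a connection form: the value does not depend on the chosen lift \<open>\<delta>q\<close> of
  \<open>\<delta>m\<close>.
\<close>

definition horizontal_lift ::
  "('g, 'x) monoid_scheme \<Rightarrow> ('g, 'k::real_normed_vector) atlas \<Rightarrow>
   ('q, 'e::real_normed_vector) atlas \<Rightarrow> ('m, 'f::real_normed_vector) atlas \<Rightarrow>
   ('g \<Rightarrow> 'q \<Rightarrow> 'q) \<Rightarrow> ('q \<Rightarrow> 'm) \<Rightarrow>
   (('q, 'e) tangent \<Rightarrow> ('g, 'k) tangent) \<Rightarrow> 'q \<Rightarrow> ('m, 'f) tangent \<Rightarrow> ('q, 'e) tangent" where
  "horizontal_lift G AG AQ AM l \<phi> \<A> q \<delta>m =
     (let \<delta>q = (SOME \<delta>q. \<delta>q \<in> tspace AQ q \<and> tmap AQ AM \<phi> \<delta>q = \<delta>m)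
      in tdiff \<delta>q (inf_gen G AG AQ l (\<A> \<delta>q) q))"

definition D_type ::
  "('g, 'x) monoid_scheme \<Rightarrow> ('q, 'e::real_normed_vector) atlas \<Rightarrow> ('g \<Rightarrow> 'q \<Rightarrow> 'q) \<Rightarrow>
   ('q \<times> 'q) set \<Rightarrow> bool" where
  "D_type G AQ l U \<longleftrightarrow>
     openin (mtop (prod_atlas AQ AQ)) U \<and>
     (\<forall>(q, q')\<in>U. \<forall>g\<in>carrier G. \<forall>g'\<in>carrier G. (l g q, l g' q') \<in> U) \<and>
     (\<forall>q\<in>mcarrier AQ. (q, q) \<in> U)"

definition discrete_connection_form ::
  "('g, 'x) monoid_scheme \<Rightarrow> ('g, 'k::real_normed_vector) atlas \<Rightarrow>
   ('q, 'e::real_normed_vector) atlas \<Rightarrow> ('g \<Rightarrow> 'q \<Rightarrow> 'q) \<Rightarrow>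
   ('q \<times> 'q) set \<Rightarrow> ('q \<times> 'q \<Rightarrow> 'g) \<Rightarrow> bool" where
  "discrete_connection_form G AG AQ l U Ad \<longleftrightarrow>
     D_type G AQ l U \<and>
     smooth_map (prod_atlas AQ AQ) U AG Ad \<and>
     (\<forall>q\<in>mcarrier AQ. Ad (q, q) = \<one>\<^bsub>G\<^esub>) \<and>
     (\<forall>(q, q')\<in>U. \<forall>g\<in>carrier G. \<forall>g'\<in>carrier G.
        Ad (l g q, l g' q') = g' \<otimes>\<^bsub>G\<^esub> Ad (q, q') \<otimes>\<^bsub>G\<^esub> inv\<^bsub>G\<^esub> g)"

text \<open>
  The correspondence between a discrete connection form on \<open>U\<close> and a discrete horizontal lift on
  \<open>(id \<times> \<phi>) ` U\<close>.
\<close>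

definition corresponds ::
  "('g, 'x) monoid_scheme \<Rightarrow> ('q, 'e::real_normed_vector) atlas \<Rightarrow>
   ('g \<Rightarrow> 'q \<Rightarrow> 'q) \<Rightarrow> ('q \<Rightarrow> 'm) \<Rightarrow> ('q \<times> 'q) set \<Rightarrow>
   ('q \<times> 'q \<Rightarrow> 'g) \<Rightarrow> ('q \<times> 'm \<Rightarrow> 'q \<times> 'q) \<Rightarrow> bool" where
  "corresponds G AQ l \<phi> U Ad lift \<longleftrightarrow>
     (\<forall>(q, m) \<in> map_prod id \<phi> ` U. \<forall>q'\<in>mcarrier AQ. \<phi> q' = m \<longrightarrow>
        lift (q, m) = (q, l (inv\<^bsub>G\<^esub> (Ad (q, q'))) q'))"

text \<open>The partial derivative \<open>D\<^sub>2 \<A>\<^sub>d (q, q)\<close> is the tangent map of \<open>\<A>\<^sub>d (q, _)\<close> at \<open>q\<close>;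
  it maps \<open>v\<close> to \<open>T \<A>\<^sub>d (0, v)\<close>.\<close>

definition derived_connection ::
  "('g, 'k::real_normed_vector) atlas \<Rightarrow> ('q, 'e::real_normed_vector) atlas \<Rightarrow>
   ('q \<times> 'q \<Rightarrow> 'g) \<Rightarrow> ('q, 'e) tangent \<Rightarrow> ('g, 'k) tangent" where
  "derived_connection AG AQ Ad v = tmap AQ AG (\<lambda>q'. Ad (fst v, q')) v"


section \<open>Retractions\<close>

text \<open>The canonical identification of \<open>T\<^sub>x X\<close> with the tangent space of \<open>T\<^sub>x X\<close> at its zero.\<close>

definition tspace_ident ::
  "('a, 'e::real_normed_vector) atlas \<Rightarrow> ('a, 'e) tangent \<Rightarrow> (('a, 'e) tangent, 'e) tangent" where
  "tspace_ident A v = velocity (tspace_atlas A (fst v)) (\<lambda>t. tscale t v) 0"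

definition smooth_retraction ::
  "('a, 'e::real_normed_vector) atlas \<Rightarrow> ('a, 'e) tangent set \<Rightarrow> (('a, 'e) tangent \<Rightarrow> 'a) \<Rightarrow> bool" where
  "smooth_retraction A Z R \<longleftrightarrow>
     tzero ` mcarrier A \<subseteq> Z \<and>
     smooth_map (tbundle A) Z A R \<and>
     (\<forall>x\<in>mcarrier A. R (tzero x) = x \<and>
        (\<forall>v\<in>tspace A x. tmap (tspace_atlas A x) A R (tspace_ident A v) = v))"

definition extended_retraction ::
  "(('a, 'e) tangent \<Rightarrow> 'a) \<Rightarrow> ('a, 'e) tangent \<Rightarrow> 'a \<times> 'a" where
  "extended_retraction R v = (fst v, R v)"

definition equivariant_retraction ::
  "('g, 'x) monoid_scheme \<Rightarrow> ('q, 'e::real_normed_vector) atlas \<Rightarrow> ('g \<Rightarrow> 'q \<Rightarrow> 'q) \<Rightarrow>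
   ('q, 'e) tangent set \<Rightarrow> (('q, 'e) tangent \<Rightarrow> 'q) \<Rightarrow> bool" where
  "equivariant_retraction G AQ l Z R \<longleftrightarrow>
     smooth_retraction AQ Z R \<and>
     (\<forall>g\<in>carrier G. \<forall>v\<in>Z. tmap AQ AQ (l g) v \<in> Z \<and> R (tmap AQ AQ (l g) v) = l g (R v))"

text \<open>
  The reduced retraction and its domain, for \<open>h\<close> the horizontal lift; neither depends on the choice
  of \<open>q\<close> in the fibre.
\<close>

definition reduced_domain ::
  "('q, 'e::real_normed_vector) atlas \<Rightarrow> ('m, 'f::real_normed_vector) atlas \<Rightarrow> ('q \<Rightarrow> 'm) \<Rightarrow>
   ('q \<Rightarrow> ('m, 'f) tangent \<Rightarrow> ('q, 'e) tangent) \<Rightarrow> ('q, 'e) tangent set \<Rightarrow> ('m, 'f) tangent set" where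
  "reduced_domain AQ AM \<phi> h Z =
     {\<delta>m \<in> tcarrier AM. \<exists>q\<in>mcarrier AQ. \<phi> q = fst \<delta>m \<and> h q \<delta>m \<in> Z}"

definition reduced_retraction ::
  "('q, 'e::real_normed_vector) atlas \<Rightarrow> ('q \<Rightarrow> 'm) \<Rightarrow>
   ('q \<Rightarrow> ('m, 'f::real_normed_vector) tangent \<Rightarrow> ('q, 'e) tangent) \<Rightarrow>
   (('q, 'e) tangent \<Rightarrow> 'q) \<Rightarrow> ('m, 'f) tangent \<Rightarrow> 'm" where
  "reduced_retraction AQ \<phi> h R \<delta>m =
     (let q = (SOME q. q \<in> mcarrier AQ \<and> \<phi> q = fst \<delta>m) in \<phi> (R (h q \<delta>m)))"

end

(* Write q' = l (A_d(q,q')) (s(q')) near q, where the correspondence identifies s(q') with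
   R (h (q, u(q'))) and u(q') in T_m M is the inverse image of (m, phi q') under the extended reduced
   retraction. Differentiating at q' = q, and using that R is the identity to first order and that
   h (q, _) is linear, a tangent vector v at q splits as the infinitesimal generator of D_2 A_d (q,q) v
   plus a horizontal vector. Applying A gives the claim. *)
theory Submission
  imports Defs
begin

text \<open>All vectors \<open>h q (u q')\<close> lie in the single tangent space at q, so R is
  differentiated along one fibre only, where the retraction axiom applies. The derivative of the
  inverse of the extended reduced retraction is never computed: whatever it is, the second summand
  stays in the range of the lift, on which \<A> vanishes. The obstacle lies in the first summand.
  \<A> is normalised on infinitesimal generators, and these are defined through
  \<open>lie_exp\<close>, that is, through a definite description. Existence and uniqueness of
  one-parameter subgroups must therefore be settled before a generator can be identified with a
  value of the derivative of the orbit map. Uniqueness is proved directly; existence is extracted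
  from the connection form itself. Tangent vectors are families of coordinates and
  \<open>tmap\<close> selects a chart by \<open>SOME\<close>, so all computations run through a
  calculus of derivatives in explicitly named charts.\<close>

section \<open>Charts and the topology they induce\<close>

definition chart :: "('a, 'e::real_normed_vector) chart \<Rightarrow> bool" where
  "chart c \<longleftrightarrow> inj_on (snd c) (fst c) \<and> open (snd c ` fst c)"

text \<open>
  This much of an atlas suffices to control \<open>mtop\<close>; so only first derivatives of the transition maps
  are needed to handle the tangent bundle.
\<close>

definition pre_atlas :: "('a, 'e::real_normed_vector) atlas \<Rightarrow> bool" where
  "pre_atlas A \<longleftrightarrow>
     (\<forall>c\<in>A. inj_on (snd c) (fst c)) \<and> (\<forall>c\<in>A. \<forall>d\<in>A. open (snd c ` (fst c \<inter> fst d)))"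

lemma smooth_atlas_imp_pre_atlas: "smooth_atlas A \<Longrightarrow> pre_atlas A"
  by (auto simp: smooth_atlas_def pre_atlas_def)

lemma pre_atlas_imp_chart:
  assumes "pre_atlas A" "c \<in> A"
  shows "chart c"
  using assms unfolding pre_atlas_def chart_def by (metis inf.idem)

text \<open>Images under a chart commute with unions always, and with intersections because the
  chart is injective; this gives the topology axioms for the predicate inside
  \<open>mtop\<close>.\<close>

lemma openin_mtop_pre_atlas:
  assumes "pre_atlas A"
  shows "openin (mtop A) W \<longleftrightarrow> W \<subseteq> mcarrier A \<and> (\<forall>c\<in>A. open (snd c ` (fst c \<inter> W)))"
proof -
  have inter: "snd c ` (fst c \<inter> (S \<inter> T)) = snd c ` (fst c \<inter> S) \<inter> snd c ` (fst c \<inter> T)"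
    if "c \<in> A" for c S T
    using assms that by (auto simp: pre_atlas_def inj_on_def)
  have union: "snd c ` (fst c \<inter> \<Union>\<K>) = (\<Union>K\<in>\<K>. snd c ` (fst c \<inter> K))" for c :: "('a, 'b) chart" and \<K>
    by auto
  have "istopology (\<lambda>W. W \<subseteq> mcarrier A \<and> (\<forall>c\<in>A. open (snd c ` (fst c \<inter> W))))"
    unfolding istopology_def by (auto simp: inter union intro!: open_Int open_UN)
  then show ?thesis
    by (simp add: mtop_def topology_inverse')
qed

lemma topspace_mtop_pre_atlas:
  assumes "pre_atlas A"
  shows "topspace (mtop A) = mcarrier A"
proof -
  have "fst c \<inter> mcarrier A = fst c" if "c \<in> A" for c
    using that by (auto simp: mcarrier_def)
  then have "openin (mtop A) (mcarrier A)"
    using pre_atlas_imp_chart[OF assms] by (auto simp: openin_mtop_pre_atlas[OF assms] chart_def)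
  then show ?thesis
    by (meson assms openin_mtop_pre_atlas openin_subset openin_topspace subset_antisym)
qed

lemma openin_chart_domain:
  assumes "pre_atlas A" "c \<in> A"
  shows "openin (mtop A) (fst c)"
  using assms by (auto simp: openin_mtop_pre_atlas mcarrier_def) (auto simp: pre_atlas_def)

lemma charts_at_exists: "p \<in> mcarrier A \<Longrightarrow> \<exists>c. c \<in> charts_at A p"
  by (auto simp: mcarrier_def charts_at_def)

lemma chart_inv_apply [simp]: "chart c \<Longrightarrow> p \<in> fst c \<Longrightarrow> chart_inv c (snd c p) = p"
  by (simp add: chart_def chart_inv_def)

lemma eventually_in_chart_image:
  "chart c \<Longrightarrow> p \<in> fst c \<Longrightarrow> \<forall>\<^sub>F x in nhds (snd c p). x \<in> snd c ` fst c"
  by (auto simp: chart_def intro!: eventually_nhds_in_open)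

lemma chart_inv_mem: "x \<in> snd c ` fst c \<Longrightarrow> chart_inv c x \<in> fst c"
  by (metis chart_inv_def inv_into_into)

lemma apply_chart_inv: "x \<in> snd c ` fst c \<Longrightarrow> snd c (chart_inv c x) = x"
  by (metis chart_inv_def f_inv_into_f)

section \<open>Derivatives in charts\<close>

text \<open>\<open>D\<close> is the derivative of \<open>f\<close> at \<open>p\<close> read in the
  charts \<open>c\<close> and \<open>d\<close>. The condition that \<open>f\<close> stays in the
  domain of \<open>d\<close> near \<open>p\<close> is included because \<open>snd d\<close> is
  arbitrary elsewhere; without it the derivative would say nothing about \<open>f\<close>, and the
  chain rule would fail. Charts are arguments, not members of an atlas, so model spaces and tangent
  bundles are covered too.\<close>

definition has_mderiv ::
  "('a, 'e::real_normed_vector) chart \<Rightarrow> ('b, 'f::real_normed_vector) chart \<Rightarrow>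
   ('a \<Rightarrow> 'b) \<Rightarrow> ('e \<Rightarrow> 'f) \<Rightarrow> 'a \<Rightarrow> bool" where
  "has_mderiv c d f D p \<longleftrightarrow>
     chart c \<and> chart d \<and> p \<in> fst c \<and> f p \<in> fst d \<and>
     (\<forall>\<^sub>F x in nhds (snd c p). f (chart_inv c x) \<in> fst d) \<and>
     ((snd d \<circ> f \<circ> chart_inv c) has_derivative D) (at (snd c p))"

lemma has_mderiv_unique: "has_mderiv c d f D p \<Longrightarrow> has_mderiv c d f E p \<Longrightarrow> D = E"
  unfolding has_mderiv_def using has_derivative_unique by blast

lemma has_mderiv_bounded_linear: "has_mderiv c d f D p \<Longrightarrow> bounded_linear D"
  unfolding has_mderiv_def using has_derivative_bounded_linear by blast

lemma has_mderiv_frechet: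
  "has_mderiv c d f D p \<Longrightarrow> frechet_derivative (snd d \<circ> f \<circ> chart_inv c) (at (snd c p)) = D"
  unfolding has_mderiv_def using frechet_derivative_at by metis

lemma has_mderiv_cong:
  assumes f: "has_mderiv c d f D p"
    and eq: "\<forall>\<^sub>F x in nhds (snd c p). f (chart_inv c x) = g (chart_inv c x)"
  shows "has_mderiv c d g D p"
proof -
  have "f p = g p"
    using eventually_nhds_x_imp_x[OF eq] f by (auto simp: has_mderiv_def)
  moreover have "\<forall>\<^sub>F x in nhds (snd c p). g (chart_inv c x) \<in> fst d"
    using eq f unfolding has_mderiv_def by (auto elim: eventually_elim2)
  moreover have "((snd d \<circ> g \<circ> chart_inv c) has_derivative D) (at (snd c p))"
  proof (rule has_derivative_transform_eventually)
    show "((snd d \<circ> f \<circ> chart_inv c) has_derivative D) (at (snd c p))"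
      using f by (simp add: has_mderiv_def)
    show "\<forall>\<^sub>F x in at (snd c p). (snd d \<circ> f \<circ> chart_inv c) x = (snd d \<circ> g \<circ> chart_inv c) x"
      using eq unfolding eventually_at_filter by eventually_elim simp
  qed (use \<open>f p = g p\<close> f in \<open>auto simp: has_mderiv_def\<close>)
  ultimately show ?thesis
    using f by (simp add: has_mderiv_def)
qed

lemma has_mderiv_tendsto:
  assumes "has_mderiv c d f D p"
  shows "filterlim (\<lambda>x. snd d (f (chart_inv c x))) (nhds (snd d (f p))) (nhds (snd c p))"
proof -
  have "isCont (snd d \<circ> f \<circ> chart_inv c) (snd c p)"
    using assms has_derivative_continuous by (auto simp: has_mderiv_def)
  then have "filterlim (snd d \<circ> f \<circ> chart_inv c) (nhds ((snd d \<circ> f \<circ> chart_inv c) (snd c p))) (nhds (snd c p))"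
    using continuous_at tendsto_at_iff_tendsto_nhds by blast
  then show ?thesis
    using assms by (simp add: has_mderiv_def o_def)
qed

text \<open>Near \<open>p\<close> the values of \<open>f\<close> lie in the domain of
  \<open>d\<close>, where \<open>chart_inv d\<close> undoes \<open>snd d\<close>. So the coordinate
  expression of the composite agrees near \<open>p\<close> with the composite of the coordinate
  expressions, and the chain rule in normed spaces applies.\<close>

lemma has_mderiv_compose:
  assumes f: "has_mderiv c d f D p" and g: "has_mderiv d e g E (f p)"
  shows "has_mderiv c e (\<lambda>x. g (f x)) (\<lambda>v. E (D v)) p"
proof -
  have inv: "chart_inv d (snd d (f (chart_inv c x))) = f (chart_inv c x)"
    if "f (chart_inv c x) \<in> fst d" for x
    using that f by (simp add: has_mderiv_def)
  have ev: "\<forall>\<^sub>F x in nhds (snd c p). f (chart_inv c x) \<in> fst d"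
    using f by (simp add: has_mderiv_def)
  have "\<forall>\<^sub>F y in nhds (snd d (f p)). g (chart_inv d y) \<in> fst e"
    using g by (simp add: has_mderiv_def)
  from eventually_compose_filterlim[OF this has_mderiv_tendsto[OF f]]
  have 1: "\<forall>\<^sub>F x in nhds (snd c p). g (f (chart_inv c x)) \<in> fst e"
    using ev by eventually_elim (simp add: inv)
  have fc: "chart_inv c (snd c p) = p"
    using f by (simp add: has_mderiv_def)
  have "((snd e \<circ> g \<circ> chart_inv d) \<circ> (snd d \<circ> f \<circ> chart_inv c) has_derivative E \<circ> D) (at (snd c p))"
    by (rule diff_chain_at) (use f g fc in \<open>auto simp: has_mderiv_def\<close>)
  then have 2: "((snd e \<circ> (\<lambda>x. g (f x)) \<circ> chart_inv c) has_derivative (\<lambda>v. E (D v))) (at (snd c p))"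
    unfolding o_def[of E D]
  proof (rule has_derivative_transform_eventually)
    show "\<forall>\<^sub>F x in at (snd c p). (snd e \<circ> g \<circ> chart_inv d \<circ> (snd d \<circ> f \<circ> chart_inv c)) x =
        (snd e \<circ> (\<lambda>x. g (f x)) \<circ> chart_inv c) x"
      using ev unfolding eventually_at_filter by eventually_elim (simp add: inv)
  qed (use f fc in \<open>auto simp: has_mderiv_def\<close>)
  show ?thesis
    using 1 2 f g by (simp add: has_mderiv_def)
qed

lemma has_mderiv_const:
  "chart c \<Longrightarrow> chart d \<Longrightarrow> p \<in> fst c \<Longrightarrow> k \<in> fst d \<Longrightarrow> has_mderiv c d (\<lambda>x. k) (\<lambda>v. 0) p"
  by (simp add: has_mderiv_def o_def)

lemma has_mderiv_ident:
  assumes "chart c" "p \<in> fst c"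
  shows "has_mderiv c c (\<lambda>x. x) (\<lambda>v. v) p"
proof -
  have ev: "\<forall>\<^sub>F x in nhds (snd c p). x \<in> snd c ` fst c"
    by (rule eventually_in_chart_image[OF assms])
  have "((snd c \<circ> (\<lambda>x. x) \<circ> chart_inv c) has_derivative (\<lambda>v. v)) (at (snd c p))"
  proof (rule has_derivative_transform_eventually[OF has_derivative_ident])
    show "\<forall>\<^sub>F x in at (snd c p). x = (snd c \<circ> (\<lambda>x. x) \<circ> chart_inv c) x"
      using ev unfolding eventually_at_filter by eventually_elim (simp add: apply_chart_inv)
  qed (use assms in auto)
  moreover have "\<forall>\<^sub>F x in nhds (snd c p). chart_inv c x \<in> fst c"
    using ev by eventually_elim (rule chart_inv_mem)
  ultimately show ?thesis
    using assms by (simp add: has_mderiv_def)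
qed

section \<open>Product charts and model spaces\<close>

definition prod_chart ::
  "('a, 'e) chart \<Rightarrow> ('b, 'f) chart \<Rightarrow> ('a \<times> 'b, 'e \<times> 'f) chart" where
  "prod_chart c d = (fst c \<times> fst d, map_prod (snd c) (snd d))"

lemma fst_prod_chart [simp]: "fst (prod_chart c d) = fst c \<times> fst d"
  and snd_prod_chart [simp]: "snd (prod_chart c d) (x, y) = (snd c x, snd d y)"
  by (simp_all add: prod_chart_def)

lemma prod_atlas_eq: "prod_atlas A B = (\<lambda>(c, d). prod_chart c d) ` (A \<times> B)"
  by (simp add: prod_atlas_def prod_chart_def)

lemma snd_prod_chart_image: "snd (prod_chart c d) ` (S \<times> T) = (snd c ` S) \<times> (snd d ` T)"
  by (auto simp: prod_chart_def image_paired_Times map_prod_def)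

lemma chart_prod_chart:
  assumes "chart c" "chart d"
  shows "chart (prod_chart c d)"
  using assms by (auto simp: chart_def snd_prod_chart_image intro: open_Times)
    (auto simp: prod_chart_def intro: map_prod_inj_on)

lemma chart_inv_prod_chart:
  assumes "chart c" "chart d" "x \<in> snd c ` fst c" "y \<in> snd d ` fst d"
  shows "chart_inv (prod_chart c d) (x, y) = (chart_inv c x, chart_inv d y)"
proof -
  have "(x, y) = snd (prod_chart c d) (chart_inv c x, chart_inv d y)"
    by (simp add: apply_chart_inv assms)
  then show ?thesis
    by (metis chart_inv_apply chart_inv_mem chart_prod_chart assms fst_prod_chart mem_Sigma_iff)
qed

lemma pre_atlas_prod:
  assumes "pre_atlas A" "pre_atlas B"
  shows "pre_atlas (prod_atlas A B)"
proof -
  have "snd (prod_chart c d) ` (fst (prod_chart c d) \<inter> fst (prod_chart c' d')) =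
      (snd c ` (fst c \<inter> fst c')) \<times> (snd d ` (fst d \<inter> fst d'))"
    for c c' :: "('a, 'b) chart" and d d' :: "('c, 'd) chart"
    by (simp add: Times_Int_Times snd_prod_chart_image)
  moreover have "inj_on (snd (prod_chart c d)) (fst (prod_chart c d))" if "c \<in> A" "d \<in> B" for c d
    using chart_prod_chart[OF pre_atlas_imp_chart[OF assms(1) that(1)] pre_atlas_imp_chart[OF assms(2) that(2)]]
    by (simp add: chart_def)
  ultimately show ?thesis
    using assms by (auto simp: pre_atlas_def prod_atlas_eq simp del: fst_prod_chart intro!: open_Times)
qed

lemma prod_chart_in_charts_at:
  "c \<in> charts_at A p \<Longrightarrow> d \<in> charts_at B q \<Longrightarrow> prod_chart c d \<in> charts_at (prod_atlas A B) (p, q)"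
  by (auto simp: charts_at_def prod_atlas_eq)

lemma has_mderiv_Pair:
  assumes f: "has_mderiv c d f D p" and g: "has_mderiv c e g E p"
  shows "has_mderiv c (prod_chart d e) (\<lambda>x. (f x, g x)) (\<lambda>v. (D v, E v)) p"
proof -
  have "((\<lambda>x. ((snd d \<circ> f \<circ> chart_inv c) x, (snd e \<circ> g \<circ> chart_inv c) x)) has_derivative
      (\<lambda>v. (D v, E v))) (at (snd c p))"
    using f g by (intro has_derivative_Pair) (simp_all add: has_mderiv_def o_def)
  moreover have "(\<lambda>x. ((snd d \<circ> f \<circ> chart_inv c) x, (snd e \<circ> g \<circ> chart_inv c) x)) =
      snd (prod_chart d e) \<circ> (\<lambda>x. (f x, g x)) \<circ> chart_inv c"
    by auto
  ultimately show ?thesis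
    using f g by (auto simp: has_mderiv_def chart_prod_chart eventually_conj_iff)
qed

lemma has_mderiv_fst:
  assumes "chart c" "chart d" "p \<in> fst c" "q \<in> fst d"
  shows "has_mderiv (prod_chart c d) c fst fst (p, q)"
proof -
  have ev: "\<forall>\<^sub>F x in nhds (snd c p, snd d q). x \<in> snd (prod_chart c d) ` fst (prod_chart c d)"
    using eventually_in_chart_image[OF chart_prod_chart[OF assms(1,2)], of "(p, q)"] assms by simp
  then have ev': "\<forall>\<^sub>F x in nhds (snd c p, snd d q).
      fst (chart_inv (prod_chart c d) x) \<in> fst c \<and> snd c (fst (chart_inv (prod_chart c d) x)) = fst x"
    by eventually_elim
      (use assms in \<open>auto simp: snd_prod_chart_image chart_inv_prod_chart\<close>)
  have "((snd c \<circ> fst \<circ> chart_inv (prod_chart c d)) has_derivative fst) (at (snd c p, snd d q))"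
  proof (rule has_derivative_transform_eventually)
    show "(fst has_derivative fst) (at (snd c p, snd d q))"
      by (auto intro!: derivative_eq_intros)
    show "\<forall>\<^sub>F x in at (snd c p, snd d q). fst x = (snd c \<circ> fst \<circ> chart_inv (prod_chart c d)) x"
      using ev' unfolding eventually_at_filter by eventually_elim simp
  qed (use assms in \<open>auto simp: chart_inv_prod_chart\<close>)
  moreover have "\<forall>\<^sub>F x in nhds (snd c p, snd d q). fst (chart_inv (prod_chart c d) x) \<in> fst c"
    using ev' by eventually_elim simp
  ultimately show ?thesis
    using assms by (simp add: has_mderiv_def chart_prod_chart)
qed

text \<open>Makes a normed space its own chart, so that curves, coordinate functions and linear maps
  enter the same chain rule as maps between manifolds.\<close>

definition id_chart :: "('e, 'e::real_normed_vector) chart" where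
  "id_chart = (UNIV, \<lambda>x. x)"

lemma fst_id_chart [simp]: "fst id_chart = UNIV"
  and snd_id_chart [simp]: "snd id_chart x = x"
  by (simp_all add: id_chart_def)

lemma chart_id_chart [simp]: "chart id_chart"
  by (simp add: chart_def id_chart_def)

lemma chart_inv_id_chart [simp]: "chart_inv id_chart x = x"
  using chart_inv_apply[of id_chart x] by simp

lemma has_mderiv_id_chart:
  "has_mderiv id_chart id_chart f D p \<longleftrightarrow> (f has_derivative D) (at p)"
  by (simp add: has_mderiv_def o_def)

lemma has_mderiv_linear: "bounded_linear L \<Longrightarrow> has_mderiv id_chart id_chart L L p"
  by (simp add: has_mderiv_id_chart bounded_linear_imp_has_derivative)

lemma real_atlas_eq: "real_atlas = {id_chart}"
  by (simp add: real_atlas_def id_chart_def)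

lemma pre_atlas_real_atlas: "pre_atlas real_atlas"
  by (auto simp: pre_atlas_def real_atlas_def)

lemma mtop_real_atlas: "mtop real_atlas = euclidean"
  by (simp add: topology_eq openin_mtop_pre_atlas[OF pre_atlas_real_atlas])
    (simp add: real_atlas_def mcarrier_def)

section \<open>First-order consequences of smoothness\<close>

lemma smooth_on_imp_differentiable: "smooth_on S f \<Longrightarrow> x \<in> S \<Longrightarrow> f differentiable (at x)"
  unfolding smooth_on_def by (metis Ck_on.simps(2))

lemma smooth_map_mem:
  assumes "smooth_map A S B f" "pre_atlas A" "pre_atlas B" "p \<in> S"
  shows "f p \<in> mcarrier B" "p \<in> mcarrier A"
proof -
  have S: "openin (mtop A) S"
    using assms by (simp add: smooth_map_def)
  then show "p \<in> mcarrier A"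
    using assms openin_subset topspace_mtop_pre_atlas by blast
  then have "p \<in> topspace (subtopology (mtop A) S)"
    using assms by (simp add: topspace_mtop_pre_atlas)
  then have "f p \<in> topspace (mtop B)"
    using assms(1) continuous_map_image_subset_topspace unfolding smooth_map_def by blast
  then show "f p \<in> mcarrier B"
    using assms topspace_mtop_pre_atlas by blast
qed

text \<open>This is where the continuity clause of \<open>smooth_map\<close> pays off: it makes the
  set on which the coordinate expression is smooth an open one.\<close>

lemma smooth_map_open_preimage:
  assumes f: "smooth_map A S B f" and AB: "pre_atlas A" "pre_atlas B" and c: "c \<in> A" and d: "d \<in> B"
  shows "open (snd c ` (fst c \<inter> S \<inter> f -` fst d))"
proof -
  have S: "openin (mtop A) S"
    using f by (simp add: smooth_map_def)
  have "openin (subtopology (mtop A) S) {x \<in> topspace (subtopology (mtop A) S). f x \<in> fst d}"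
    using f openin_chart_domain[OF AB(2) d] unfolding smooth_map_def
    by (blast intro: openin_continuous_map_preimage)
  then have "openin (mtop A) {x \<in> topspace (subtopology (mtop A) S). f x \<in> fst d}"
    using S openin_trans_full by blast
  moreover have "fst c \<inter> {x \<in> topspace (subtopology (mtop A) S). f x \<in> fst d} = fst c \<inter> S \<inter> f -` fst d"
    using c by (auto simp: topspace_mtop_pre_atlas[OF AB(1)] mcarrier_def)
  ultimately show ?thesis
    using c openin_mtop_pre_atlas[OF AB(1)] by metis
qed

text \<open>The bridge from \<open>smooth_map\<close> to derivatives in charts. The derivative is
  only asserted to exist; later arguments identify it through uniqueness.\<close>

lemma smooth_map_has_mderiv:
  assumes f: "smooth_map A S B f" and AB: "pre_atlas A" "pre_atlas B" and p: "p \<in> S"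
    and c: "c \<in> charts_at A p" and d: "d \<in> charts_at B (f p)"
  obtains D where "has_mderiv c d f D p"
proof -
  let ?O = "snd c ` (fst c \<inter> S \<inter> f -` fst d)"
  have cA: "c \<in> A" "p \<in> fst c" and dB: "d \<in> B" "f p \<in> fst d"
    using c d by (auto simp: charts_at_def)
  have ch: "chart c" "chart d"
    using AB cA dB pre_atlas_imp_chart by blast+
  have mem: "snd c p \<in> ?O"
    using cA dB p by auto
  have "open ?O"
    using smooth_map_open_preimage f AB cA(1) dB(1) by blast
  then have ev: "\<forall>\<^sub>F x in nhds (snd c p). x \<in> ?O"
    using mem eventually_nhds_in_open by blast
  have "\<forall>\<^sub>F x in nhds (snd c p). f (chart_inv c x) \<in> fst d"
    using ev by eventually_elim (use ch in auto)
  moreover have "(snd d \<circ> f \<circ> chart_inv c) differentiable (at (snd c p))"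
    by (rule smooth_on_imp_differentiable[OF _ mem])
       (use f cA dB in \<open>auto simp: smooth_map_def\<close>)
  ultimately show thesis
    using that ch cA dB unfolding has_mderiv_def differentiable_def by blast
qed

lemma openin_imp_eventually_chart:
  assumes "pre_atlas A" "openin (mtop A) S" "p \<in> S" "c \<in> charts_at A p"
  shows "\<forall>\<^sub>F x in nhds (snd c p). chart_inv c x \<in> S"
proof -
  have cA: "c \<in> A" "p \<in> fst c"
    using assms by (auto simp: charts_at_def)
  have "open (snd c ` (fst c \<inter> S))"
    using assms cA by (simp add: openin_mtop_pre_atlas)
  then have "\<forall>\<^sub>F x in nhds (snd c p). x \<in> snd c ` (fst c \<inter> S)"
    using cA assms by (intro eventually_nhds_in_open) auto
  then show ?thesis
    by eventually_elim (use pre_atlas_imp_chart[OF assms(1) cA(1)] in auto)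
qed

lemma charts_atD:
  assumes "pre_atlas A" "c \<in> charts_at A p"
  shows "chart c" "p \<in> fst c"
  using assms pre_atlas_imp_chart[of A c] by (auto simp: charts_at_def)

text \<open>The partial derivatives arise by composing with the insertions that keep one factor
  constant.\<close>

lemma has_mderiv_slice:
  assumes f: "has_mderiv (prod_chart c d) e f D (p, q)"
    and cd: "chart c" "chart d" "p \<in> fst c" "q \<in> fst d"
  shows "has_mderiv c e (\<lambda>x. f (x, q)) (\<lambda>u. D (u, 0)) p"
    and "has_mderiv d e (\<lambda>y. f (p, y)) (\<lambda>v. D (0, v)) q"
  using has_mderiv_compose[OF has_mderiv_Pair[OF has_mderiv_ident has_mderiv_const] f]
    has_mderiv_compose[OF has_mderiv_Pair[OF has_mderiv_const has_mderiv_ident] f] cd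
  by auto

lemma has_mderiv_prod_split:
  assumes "has_mderiv (prod_chart c d) e f D x"
  shows "D (u, v) = D (u, 0) + D (0, v)"
  using linear_add[OF bounded_linear.linear[OF has_mderiv_bounded_linear[OF assms]], of "(u, 0)" "(0, v)"]
  by simp

lemma has_mderiv_eventually_mem:
  assumes f: "has_mderiv c d f D p" and B: "pre_atlas B" "openin (mtop B) S" "f p \<in> S"
    and d: "d \<in> charts_at B (f p)"
  shows "\<forall>\<^sub>F x in nhds (snd c p). f (chart_inv c x) \<in> S"
proof -
  have ev: "\<forall>\<^sub>F x in nhds (snd c p). f (chart_inv c x) \<in> fst d" and ch: "chart d"
    using f by (auto simp: has_mderiv_def)
  show ?thesis
    using eventually_compose_filterlim[OF openin_imp_eventually_chart[OF B d] has_mderiv_tendsto[OF f]] ev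
    by eventually_elim (simp add: ch)
qed

lemma has_mderiv_cong_open:
  assumes f: "has_mderiv c d f D p" and A: "pre_atlas A" "c \<in> charts_at A p"
    and S: "openin (mtop A) S" "p \<in> S" and eq: "\<And>x. x \<in> S \<Longrightarrow> f x = g x"
  shows "has_mderiv c d g D p"
  by (rule has_mderiv_cong[OF f])
    (use openin_imp_eventually_chart[OF A(1) S A(2)] in \<open>eventually_elim, simp add: eq\<close>)

text \<open>Serves to read off a derivative from an algebraic identity: unit laws give partial
  derivatives of multiplication and action, and mutually inverse maps give mutually inverse
  derivatives.\<close>

lemma has_mderiv_ident_unique:
  assumes f: "has_mderiv c c f D p" and A: "pre_atlas A" "c \<in> charts_at A p"
    and S: "openin (mtop A) S" "p \<in> S" and eq: "\<And>x. x \<in> S \<Longrightarrow> f x = x"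
  shows "D v = v"
  using has_mderiv_unique[OF has_mderiv_cong_open[OF f A S eq] has_mderiv_ident[OF charts_atD[OF A]]]
  by simp

section \<open>Tangent vectors in charts\<close>

definition transition :: "('a, 'e::real_normed_vector) chart \<Rightarrow> ('a, 'e) chart \<Rightarrow> 'a \<Rightarrow> 'e \<Rightarrow> 'e" where
  "transition c d p = frechet_derivative (snd d \<circ> chart_inv c) (at (snd c p))"

text \<open>A change of coordinates is the identity map read in two charts. The laws for
  \<open>transition\<close> thereby become instances of the chain rule and of uniqueness.\<close>

lemma transition_has_mderiv:
  assumes "smooth_atlas A" "c \<in> charts_at A p" "d \<in> charts_at A p"
  shows "has_mderiv c d (\<lambda>x. x) (transition c d p) p"
proof -
  let ?O = "snd c ` (fst c \<inter> fst d)"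
  have cd: "c \<in> A" "d \<in> A" "p \<in> fst c" "p \<in> fst d"
    using assms by (auto simp: charts_at_def)
  have ch: "chart c" "chart d"
    using assms(1) cd pre_atlas_imp_chart smooth_atlas_imp_pre_atlas by blast+
  have mem: "snd c p \<in> ?O"
    using cd by auto
  have "open ?O" and sm: "smooth_on ?O (snd d \<circ> chart_inv c)"
    using assms(1) cd by (auto simp: smooth_atlas_def)
  then have "\<forall>\<^sub>F x in nhds (snd c p). x \<in> ?O"
    using mem eventually_nhds_in_open by blast
  then have "\<forall>\<^sub>F x in nhds (snd c p). chart_inv c x \<in> fst d"
    by eventually_elim (use ch in auto)
  moreover have "((snd d \<circ> chart_inv c) has_derivative transition c d p) (at (snd c p))"
    unfolding transition_def
    using smooth_on_imp_differentiable[OF sm mem] frechet_derivative_works by blast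
  ultimately show ?thesis
    using cd ch by (simp add: has_mderiv_def o_def)
qed

lemma transition_self [simp]:
  assumes "smooth_atlas A" "c \<in> charts_at A p"
  shows "transition c c p x = x"
proof -
  have "chart c" "p \<in> fst c"
    using assms pre_atlas_imp_chart[OF smooth_atlas_imp_pre_atlas, of A c] by (auto simp: charts_at_def)
  then show ?thesis
    using has_mderiv_unique[OF transition_has_mderiv[OF assms assms(2)] has_mderiv_ident] by simp
qed

lemma transition_trans:
  assumes "smooth_atlas A" "c \<in> charts_at A p" "d \<in> charts_at A p" "e \<in> charts_at A p"
  shows "transition d e p (transition c d p x) = transition c e p x"
  using has_mderiv_unique[OF has_mderiv_compose[OF transition_has_mderiv transition_has_mderiv]
      transition_has_mderiv] assms by metis

lemma tspaceI:
  assumes "fst w = p" "\<And>c. c \<notin> charts_at A p \<Longrightarrow> snd w c = 0"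
    and "\<And>c d. c \<in> charts_at A p \<Longrightarrow> d \<in> charts_at A p \<Longrightarrow> snd w d = transition c d p (snd w c)"
  shows "w \<in> tspace A p"
  using assms unfolding tspace_def transition_def by blast

lemma tspace_fst: "w \<in> tspace A p \<Longrightarrow> fst w = p"
  and tspace_off_charts: "w \<in> tspace A p \<Longrightarrow> c \<notin> charts_at A p \<Longrightarrow> snd w c = 0"
  and tspace_transition:
    "w \<in> tspace A p \<Longrightarrow> c \<in> charts_at A p \<Longrightarrow> d \<in> charts_at A p \<Longrightarrow>
       snd w d = transition c d p (snd w c)"
  unfolding tspace_def transition_def by blast+

lemma linear_transition:
  "smooth_atlas A \<Longrightarrow> c \<in> charts_at A p \<Longrightarrow> d \<in> charts_at A p \<Longrightarrow> linear (transition c d p)"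
  by (meson bounded_linear.linear has_mderiv_bounded_linear transition_has_mderiv)

text \<open>The tangent vector at \<open>p\<close> with coordinate \<open>x\<close> in the chart
  \<open>c\<close>; it inverts the coordinate map of \<open>tspace A p\<close>. The value 0 away
  from the charts at \<open>p\<close> is the normalisation demanded by
  \<open>tspace\<close>.\<close>

definition tvec ::
  "('a, 'e::real_normed_vector) atlas \<Rightarrow> 'a \<Rightarrow> ('a, 'e) chart \<Rightarrow> 'e \<Rightarrow> ('a, 'e) tangent" where
  "tvec A p c x = (p, \<lambda>d. if d \<in> charts_at A p then transition c d p x else 0)"

lemma fst_tvec [simp]: "fst (tvec A p c x) = p"
  by (simp add: tvec_def)

lemma snd_tvec:
  "d \<in> charts_at A p \<Longrightarrow> snd (tvec A p c x) d = transition c d p x"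
  by (simp add: tvec_def)

lemma snd_tvec_same [simp]:
  "smooth_atlas A \<Longrightarrow> c \<in> charts_at A p \<Longrightarrow> snd (tvec A p c x) c = x"
  by (simp add: tvec_def)

lemma tvec_mem_tspace:
  "smooth_atlas A \<Longrightarrow> c \<in> charts_at A p \<Longrightarrow> tvec A p c x \<in> tspace A p"
  by (rule tspaceI) (simp_all add: tvec_def transition_trans)

text \<open>One coordinate determines all others by the transition law, and outside the charts at
  \<open>p\<close> both families are 0. Equations between tangent vectors thus reduce to a single
  chart.\<close>

lemma tspace_eqI:
  assumes "v \<in> tspace A p" "w \<in> tspace A p" "c \<in> charts_at A p" "snd v c = snd w c"
  shows "v = w"
proof (rule prod_eqI)
  show "snd v = snd w"
  proof
    fix d
    show "snd v d = snd w d"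
      using assms tspace_transition[of _ A p c d] tspace_off_charts[of _ A p d]
      by (cases "d \<in> charts_at A p") simp_all
  qed
qed (use assms in \<open>simp add: tspace_fst\<close>)

lemma tvec_coord:
  "smooth_atlas A \<Longrightarrow> c \<in> charts_at A p \<Longrightarrow> w \<in> tspace A p \<Longrightarrow> tvec A p c (snd w c) = w"
  by (metis snd_tvec_same tspace_eqI tvec_mem_tspace)

lemma tadd_mem_tspace:
  assumes A: "smooth_atlas A" and v: "v \<in> tspace A p" and w: "w \<in> tspace A p"
  shows "tadd v w \<in> tspace A p"
proof (rule tspaceI)
  fix c d assume "c \<in> charts_at A p" "d \<in> charts_at A p"
  then show "snd (tadd v w) d = transition c d p (snd (tadd v w) c)"
    using tspace_transition[OF v, of c d] tspace_transition[OF w, of c d] linear_transition[OF A, of c p d]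
    by (simp add: tadd_def linear_add)
qed (use v w in \<open>simp_all add: tadd_def tspace_fst tspace_off_charts\<close>)

lemma tscale_mem_tspace:
  assumes A: "smooth_atlas A" and v: "v \<in> tspace A p"
  shows "tscale r v \<in> tspace A p"
proof (rule tspaceI)
  fix c d assume "c \<in> charts_at A p" "d \<in> charts_at A p"
  then show "snd (tscale r v) d = transition c d p (snd (tscale r v) c)"
    using tspace_transition[OF v, of c d] linear_transition[OF A, of c p d]
    by (simp add: tscale_def linear_scale)
qed (use v in \<open>simp_all add: tscale_def tspace_fst tspace_off_charts\<close>)

lemma tdiff_eq: "tdiff v w = tadd v (tscale (- 1) w)"
  by (simp add: tdiff_def tadd_def tscale_def)

lemma tzero_eq: "p = fst v \<Longrightarrow> tzero p = tscale 0 v"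
  by (simp add: tzero_def tscale_def)

lemma tzero_mem_tspace:
  assumes "smooth_atlas A"
  shows "tzero p \<in> tspace A p"
  by (rule tspaceI) (simp_all add: tzero_def linear_0[OF linear_transition[OF assms]])

lemma tspace_subset_tcarrier: "p \<in> mcarrier A \<Longrightarrow> w \<in> tspace A p \<Longrightarrow> w \<in> tcarrier A"
  by (auto simp: tcarrier_def)

lemma tcarrier_mem_tspace: "w \<in> tcarrier A \<Longrightarrow> w \<in> tspace A (fst w)"
  by (auto simp: tcarrier_def tspace_fst)

text \<open>Removes the \<open>SOME\<close> from \<open>tmap\<close>: passing from the selected
  chart to \<open>c\<close> changes the derivative and the coordinate of \<open>v\<close> by the
  same transition, and the two changes cancel.\<close>

lemma tmap_coord:
  assumes A: "smooth_atlas A"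
    and f: "has_mderiv c d f D p" and c: "c \<in> charts_at A p" and d: "d \<in> charts_at B (f p)"
    and v: "v \<in> tspace A p"
  shows "snd (tmap A B f v) d = D (snd v c)"
proof -
  define c' where "c' = (SOME c. c \<in> charts_at A p)"
  have c': "c' \<in> charts_at A p"
    unfolding c'_def using c by (rule someI[of "\<lambda>c. c \<in> charts_at A p"])
  have "has_mderiv c' d f (\<lambda>x. D (transition c' c p x)) p"
    using has_mderiv_compose[OF transition_has_mderiv[OF A c' c] f] .
  then have "frechet_derivative (snd d \<circ> f \<circ> chart_inv c') (at (snd c' p)) (snd v c') =
      D (transition c' c p (snd v c'))"
    by (simp add: has_mderiv_frechet)
  also have "transition c' c p (snd v c') = snd v c"
    using tspace_transition[OF v c' c] by simp
  finally show ?thesis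
    using v d by (simp add: tmap_def tspace_fst Let_def o_def flip: c'_def)
qed

lemma tmap_eq_tvec:
  assumes A: "smooth_atlas A" and B: "smooth_atlas B"
    and f: "has_mderiv c d f D p" and c: "c \<in> charts_at A p" and d: "d \<in> charts_at B (f p)"
    and v: "v \<in> tspace A p"
  shows "tmap A B f v = tvec B (f p) d (D (snd v c))"
proof (rule prod_eqI)
  show "snd (tmap A B f v) = snd (tvec B (f p) d (D (snd v c)))"
  proof
    fix e
    show "snd (tmap A B f v) e = snd (tvec B (f p) d (D (snd v c))) e"
    proof (cases "e \<in> charts_at B (f p)")
      case True
      have "has_mderiv c e f (\<lambda>x. transition d e (f p) (D x)) p"
        using has_mderiv_compose[OF f transition_has_mderiv[OF B d True]] .
      from tmap_coord[OF A this c True v] show ?thesis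
        by (simp add: snd_tvec True)
    next
      case False
      then show ?thesis
        using v by (simp add: tmap_def tvec_def tspace_fst)
    qed
  qed
qed (use v in \<open>simp add: tmap_def tspace_fst\<close>)

lemma has_mderiv_real_eq_scaleR:
  assumes "has_mderiv id_chart c \<gamma> D t"
  shows "D (r::real) = r *\<^sub>R D 1"
  using linear_scale[OF bounded_linear.linear[OF has_mderiv_bounded_linear[OF assms]], of r 1]
  by simp

lemma velocity_eq_tvec:
  assumes A: "smooth_atlas A" and \<gamma>: "has_mderiv id_chart c \<gamma> D t" and c: "c \<in> charts_at A (\<gamma> t)"
  shows "velocity A \<gamma> t = tvec A (\<gamma> t) c (D 1)"
proof -
  have "vector_derivative (snd d \<circ> \<gamma>) (at t) = transition c d (\<gamma> t) (D 1)"
    if "d \<in> charts_at A (\<gamma> t)" for d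
  proof -
    have deriv: "has_mderiv id_chart d \<gamma> (\<lambda>x. transition c d (\<gamma> t) (D x)) t"
      using has_mderiv_compose[OF \<gamma> transition_has_mderiv[OF A c that]] .
    have "(\<lambda>r. transition c d (\<gamma> t) (D r)) = (\<lambda>r. r *\<^sub>R transition c d (\<gamma> t) (D 1))"
      by (rule ext) (rule has_mderiv_real_eq_scaleR[OF deriv])
    with deriv have "((snd d \<circ> \<gamma>) has_vector_derivative transition c d (\<gamma> t) (D 1)) (at t)"
      by (simp add: has_mderiv_def o_def has_vector_derivative_def)
    then show ?thesis
      by (rule vector_derivative_at)
  qed
  then show ?thesis
    by (auto simp: velocity_def tvec_def)
qed

section \<open>Charts of the tangent bundle\<close>

definition tangent_chart ::
  "('a, 'e::real_normed_vector) atlas \<Rightarrow> ('a, 'e) chart \<Rightarrow> (('a, 'e) tangent, 'e \<times> 'e) chart" where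
  "tangent_chart A c = ({w \<in> tcarrier A. fst w \<in> fst c}, \<lambda>w. (snd c (fst w), snd w c))"

lemma tbundle_eq: "tbundle A = tangent_chart A ` A"
  by (simp add: tbundle_def tangent_chart_def)

lemma tangent_chart_in_charts_at:
  "c \<in> charts_at A p \<Longrightarrow> w \<in> tspace A p \<Longrightarrow> tangent_chart A c \<in> charts_at (tbundle A) w"
  by (auto simp: charts_at_def tbundle_eq tangent_chart_def tcarrier_def tspace_fst mcarrier_def)

text \<open>Over the overlap of two charts the coordinates of tangent vectors fill the product of an
  open set with the whole model space, \<open>tvec\<close> supplying the preimages.\<close>

lemma pre_atlas_tbundle:
  fixes A :: "('a, 'e::real_normed_vector) atlas"
  assumes A: "smooth_atlas A"
  shows "pre_atlas (tbundle A)"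
proof -
  have "inj_on (snd (tangent_chart A c)) (fst (tangent_chart A c))" if "c \<in> A" for c
  proof (rule inj_onI)
    fix v w
    assume vw: "v \<in> fst (tangent_chart A c)" "w \<in> fst (tangent_chart A c)"
      "snd (tangent_chart A c) v = snd (tangent_chart A c) w"
    have "inj_on (snd c) (fst c)"
      using A that by (simp add: smooth_atlas_def)
    then have "fst v = fst w"
      using vw by (auto simp: tangent_chart_def inj_on_def)
    moreover have "c \<in> charts_at A (fst v)"
      using vw that by (auto simp: tangent_chart_def charts_at_def)
    ultimately show "v = w"
      using vw by (intro tspace_eqI[of v A "fst v" w c])
        (auto simp: tangent_chart_def dest: tcarrier_mem_tspace)
  qed
  moreover have "open (snd (tangent_chart A c) ` (fst (tangent_chart A c) \<inter> fst (tangent_chart A d)))"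
    if cd: "c \<in> A" "d \<in> A" for c d
  proof -
    have "snd (tangent_chart A c) ` (fst (tangent_chart A c) \<inter> fst (tangent_chart A d)) =
        snd c ` (fst c \<inter> fst d) \<times> (UNIV :: 'e set)"
    proof (intro equalityI subsetI)
      fix z assume "z \<in> snd c ` (fst c \<inter> fst d) \<times> (UNIV :: 'e set)"
      then obtain p and x :: 'e where p: "p \<in> fst c" "p \<in> fst d" and z: "z = (snd c p, x)"
        by auto
      have c: "c \<in> charts_at A p"
        using p cd by (simp add: charts_at_def)
      have "tvec A p c x \<in> fst (tangent_chart A c) \<inter> fst (tangent_chart A d)"
        using p cd tvec_mem_tspace[OF A c, of x] by (auto simp: tangent_chart_def tcarrier_def mcarrier_def)
      moreover have "z = snd (tangent_chart A c) (tvec A p c x)"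
        using z A c by (simp add: tangent_chart_def)
      ultimately show "z \<in> snd (tangent_chart A c) ` (fst (tangent_chart A c) \<inter> fst (tangent_chart A d))"
        by blast
    qed (auto simp: tangent_chart_def)
    then show ?thesis
      using A cd by (auto simp: smooth_atlas_def intro: open_Times)
  qed
  ultimately show ?thesis
    by (auto simp: pre_atlas_def tbundle_eq)
qed

lemma chart_tangent_chart:
  "smooth_atlas A \<Longrightarrow> c \<in> A \<Longrightarrow> chart (tangent_chart A c)"
  by (rule pre_atlas_imp_chart[OF pre_atlas_tbundle]) (auto simp: tbundle_eq)

text \<open>The inclusion of one tangent space into the tangent bundle: the base coordinate stays
  constant. Composing with it restricts \<open>R\<close> and \<A> to a fibre.\<close>

lemma has_mderiv_tvec:
  assumes A: "smooth_atlas A" and c: "c \<in> charts_at A p"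
  shows "has_mderiv id_chart (tangent_chart A c) (tvec A p c) (\<lambda>v. (0, v)) x"
proof -
  have "snd (tangent_chart A c) \<circ> tvec A p c \<circ> chart_inv id_chart = (\<lambda>x. (snd c p, x))"
    using A c by (auto simp: tangent_chart_def)
  moreover have "((\<lambda>x. (snd c p, x)) has_derivative (\<lambda>v. (0, v))) (at x)"
    by (auto intro!: derivative_eq_intros)
  moreover have "tvec A p c y \<in> fst (tangent_chart A c)" for y
    using tvec_mem_tspace[OF A c] c
    by (auto simp: tangent_chart_def charts_at_def tcarrier_def mcarrier_def)
  ultimately show ?thesis
    using c chart_tangent_chart[OF A] by (simp add: has_mderiv_def charts_at_def)
qed

text \<open>In the tangent chart this map is the second projection. It serves to differentiate a
  family of tangent vectors through its fibre coordinate.\<close>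

lemma has_mderiv_coord:
  assumes A: "smooth_atlas A" and c: "c \<in> charts_at A p" and w: "w \<in> tspace A p"
  shows "has_mderiv (tangent_chart A c) id_chart (\<lambda>w. snd w c) snd w"
proof -
  let ?T = "tangent_chart A c"
  have T: "chart ?T" "w \<in> fst ?T"
    using c chart_tangent_chart[OF A] tangent_chart_in_charts_at[OF c w] by (auto simp: charts_at_def)
  have snd_T: "snd (snd ?T v) = snd v c" for v
    by (simp add: tangent_chart_def)
  have "\<forall>\<^sub>F x in nhds (snd ?T w). x \<in> snd ?T ` fst ?T"
    by (rule eventually_in_chart_image[OF T])
  then have ev: "\<forall>\<^sub>F x in nhds (snd ?T w). snd x = snd (chart_inv ?T x) c"
  proof eventually_elim
    case (elim x)
    then obtain w' where "x = snd ?T w'" "w' \<in> fst ?T"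
      by blast
    then show ?case
      using T snd_T by simp
  qed
  have "(((\<lambda>w. snd w c) \<circ> chart_inv ?T) has_derivative snd) (at (snd ?T w))"
  proof (rule has_derivative_transform_eventually)
    show "(snd has_derivative snd) (at (snd ?T w))"
      by (auto intro!: derivative_eq_intros)
    show "\<forall>\<^sub>F x in at (snd ?T w). snd x = ((\<lambda>w. snd w c) \<circ> chart_inv ?T) x"
      using ev unfolding eventually_at_filter by eventually_elim simp
  qed (use T snd_T in simp_all)
  then show ?thesis
    using T by (simp add: has_mderiv_def o_def)
qed

section \<open>Tangent spaces as manifolds; retractions to first order\<close>

definition tspace_chart ::
  "('a, 'e::real_normed_vector) atlas \<Rightarrow> 'a \<Rightarrow> ('a, 'e) chart \<Rightarrow> (('a, 'e) tangent, 'e) chart" where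
  "tspace_chart A p c = (tspace A p, \<lambda>w. snd w c)"

lemma tspace_atlas_eq: "tspace_atlas A p = tspace_chart A p ` charts_at A p"
  by (simp add: tspace_atlas_def tspace_chart_def)

lemma inj_on_tspace_chart:
  "c \<in> charts_at A p \<Longrightarrow> inj_on (snd (tspace_chart A p c)) (fst (tspace_chart A p c))"
  unfolding tspace_chart_def inj_on_def fst_conv snd_conv by (blast intro: tspace_eqI)

lemma tspace_chart_image:
  "smooth_atlas A \<Longrightarrow> c \<in> charts_at A p \<Longrightarrow> snd (tspace_chart A p c) ` tspace A p = UNIV"
  by (auto simp: tspace_chart_def intro!: image_eqI[where x = "tvec A p c _"] tvec_mem_tspace)

lemma pre_atlas_tspace_atlas:
  assumes A: "smooth_atlas A"
  shows "pre_atlas (tspace_atlas A p)"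
  using tspace_chart_image[OF A]
  by (auto simp: pre_atlas_def tspace_atlas_eq inj_on_tspace_chart)
    (auto simp: tspace_chart_def)

lemma chart_inv_tspace_chart:
  assumes A: "smooth_atlas A" and c: "c \<in> charts_at A p"
  shows "chart_inv (tspace_chart A p c) x = tvec A p c x"
proof -
  have "chart (tspace_chart A p c)"
    using pre_atlas_imp_chart[OF pre_atlas_tspace_atlas[OF A]] c unfolding tspace_atlas_eq by blast
  from chart_inv_apply[OF this, of "tvec A p c x"] show ?thesis
    using A c tvec_mem_tspace[OF A c] by (simp add: tspace_chart_def)
qed

text \<open>The derivative exists because \<open>R\<close> is smooth on the tangent bundle and
  \<open>tvec\<close> parametrises a fibre. Its value comes from the retraction axiom, which is
  phrased by \<open>tmap\<close> on \<open>tspace_atlas\<close> and has to be unfolded at the chart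
  which that \<open>tmap\<close> selects.\<close>

lemma retraction_coord:
  assumes A: "smooth_manifold A" and R: "smooth_retraction A Z R"
    and p: "p \<in> mcarrier A" and c: "c \<in> charts_at A p"
  shows "has_mderiv id_chart c (\<lambda>x. R (tvec A p c x)) (\<lambda>v. v) 0"
proof -
  have sA: "smooth_atlas A" and pA: "pre_atlas A"
    using A by (simp_all add: smooth_manifold_def smooth_atlas_imp_pre_atlas)
  have zero: "tvec A p d 0 = tzero p" if "d \<in> charts_at A p" for d
    using sA that by (intro tspace_eqI[OF tvec_mem_tspace tzero_mem_tspace that]) (simp_all add: tzero_def)
  have Rz: "R (tzero p) = p"
    using R p by (simp add: smooth_retraction_def)
  have deriv: "\<exists>D. has_mderiv id_chart c (\<lambda>x. R (tvec A p d x)) D 0" if d: "d \<in> charts_at A p" for d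
  proof -
    have "smooth_map (tbundle A) Z A R" "tzero p \<in> Z"
      using R p by (auto simp: smooth_retraction_def)
    from smooth_map_has_mderiv[OF this(1) pre_atlas_tbundle[OF sA] pA this(2)
        tangent_chart_in_charts_at[OF d tzero_mem_tspace[OF sA]], of c]
    obtain E where "has_mderiv (tangent_chart A d) c R E (tzero p)"
      using c Rz by auto
    then show ?thesis
      using has_mderiv_compose[OF has_mderiv_tvec[OF sA d]] by (metis zero[OF d])
  qed
  obtain D where D: "has_mderiv id_chart c (\<lambda>x. R (tvec A p c x)) D 0"
    using deriv[OF c] by blast
  \<comment> \<open>\<open>k\<close> is the chart selected by \<open>SOME\<close> inside
    \<open>tmap\<close> at the zero vector, the base point of \<open>tspace_ident A v\<close>. It
    comes from some chart \<open>d\<close> that may differ from \<open>c\<close>.\<close>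
  define k where "k = (SOME k. k \<in> charts_at (tspace_atlas A p) (tzero p))"
  have charts: "charts_at (tspace_atlas A p) (tzero p) = tspace_chart A p ` charts_at A p"
    using tzero_mem_tspace[OF sA] by (auto simp: charts_at_def tspace_atlas_eq tspace_chart_def)
  have "k \<in> charts_at (tspace_atlas A p) (tzero p)"
    unfolding k_def charts using c by (intro someI_ex[of "\<lambda>k. k \<in> _"]) blast
  then obtain d where d: "d \<in> charts_at A p" and k: "k = tspace_chart A p d"
    using charts by auto
  obtain E where E: "has_mderiv id_chart c (\<lambda>x. R (tvec A p d x)) E 0"
    using deriv[OF d] by blast
  have "D x = x" for x
  proof -
    define v where "v = tvec A p c x"
    have v: "v \<in> tspace A p"
      unfolding v_def by (rule tvec_mem_tspace[OF sA c])
    have z: "tscale 0 v = tzero p"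
      using tzero_eq[of p v] v by (simp add: tspace_fst)
    have "snd (tspace_ident A v) k = vector_derivative (snd k \<circ> (\<lambda>t. tscale t v)) (at 0)"
      using d v z by (auto simp: tspace_ident_def velocity_def tspace_fst charts k)
    also have "snd k \<circ> (\<lambda>t. tscale t v) = (\<lambda>t. t *\<^sub>R snd v d)"
      by (auto simp: k tspace_chart_def tscale_def)
    also have "vector_derivative (\<lambda>t. t *\<^sub>R snd v d) (at 0) = snd v d"
      by (rule vector_derivative_at) (auto intro!: derivative_eq_intros)
    finally have "snd (tmap (tspace_atlas A p) A R (tspace_ident A v)) c =
        frechet_derivative (snd c \<circ> R \<circ> chart_inv k) (at (snd k (tzero p))) (snd v d)"
      using c v z Rz by (simp add: tmap_def tspace_ident_def velocity_def tspace_fst k_def Let_def)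
    also have "snd c \<circ> R \<circ> chart_inv k = snd c \<circ> (\<lambda>x. R (tvec A p d x)) \<circ> chart_inv id_chart"
      by (auto simp: k chart_inv_tspace_chart[OF sA d])
    also have "snd k (tzero p) = snd id_chart 0"
      by (simp add: k tspace_chart_def tzero_def)
    finally have *: "snd (tmap (tspace_atlas A p) A R (tspace_ident A v)) c = E (snd v d)"
      using has_mderiv_frechet[OF E] by (simp add: o_def)
    have "E (snd v d) = snd v c"
      using R p v * unfolding smooth_retraction_def by simp
    \<comment> \<open>Both parametrisations of the fibre differ by the linear map
      \<open>transition c d p\<close>, which fixes 0 and is its own derivative. So the axiom,
      obtained in terms of \<open>d\<close>, transfers to \<open>c\<close>.\<close>
    moreover have "D = (\<lambda>x. E (transition c d p x))"
    proof -
      have T: "has_mderiv id_chart id_chart (transition c d p) (transition c d p) 0"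
        by (rule has_mderiv_linear[OF has_mderiv_bounded_linear[OF transition_has_mderiv[OF sA c d]]])
      have T0: "transition c d p 0 = 0"
        using linear_0[OF linear_transition[OF sA c d]] .
      have "tvec A p d (transition c d p y) = tvec A p c y" for y
        using sA c d tvec_mem_tspace[OF sA c, of y] tvec_coord[OF sA d, of "tvec A p c y"]
        by (simp add: snd_tvec)
      then have "has_mderiv id_chart c (\<lambda>x. R (tvec A p c x)) (\<lambda>x. E (transition c d p x)) 0"
        using has_mderiv_compose[OF T, of c "\<lambda>x. R (tvec A p d x)" E] E T0 by simp
      then show ?thesis
        by (rule has_mderiv_unique[OF D])
    qed
    ultimately show ?thesis
      using sA c d by (simp add: v_def snd_tvec)
  qed
  then have "D = (\<lambda>v. v)"
    by blast
  then show ?thesis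
    using D by simp
qed

section \<open>One-parameter subgroups\<close>

text \<open>On a small ball the curve stays in one chart, its coordinate is constant there, and
  injectivity of the chart makes the curve locally constant; the line is connected.\<close>

lemma constant_if_mderiv_zero:
  fixes \<delta> :: "real \<Rightarrow> 'a"
  assumes mem: "\<And>t. \<delta> t \<in> mcarrier A"
    and zero: "\<And>t d. d \<in> charts_at A (\<delta> t) \<Longrightarrow> has_mderiv id_chart d \<delta> (\<lambda>x. 0) t"
  shows "\<delta> s = \<delta> t"
proof -
  have "\<delta> constant_on UNIV"
  proof (rule locally_constant_imp_constant[OF connected_UNIV])
    fix a :: real
    obtain d where d: "d \<in> charts_at A (\<delta> a)"
      using charts_at_exists[OF mem] by blast
    have ch: "chart d" and dA: "d \<in> A"
      using zero[OF d] d by (auto simp: has_mderiv_def charts_at_def)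
    have "\<forall>\<^sub>F x in nhds a. \<delta> x \<in> fst d"
      using zero[OF d] by (simp add: has_mderiv_def)
    then obtain e where e: "e > 0" "\<And>x. dist x a < e \<Longrightarrow> \<delta> x \<in> fst d"
      unfolding eventually_nhds_metric by blast
    have "((snd d \<circ> \<delta>) has_derivative (\<lambda>h. 0)) (at x within ball a e)" if "x \<in> ball a e" for x
    proof -
      have "d \<in> charts_at A (\<delta> x)"
        using e(2)[of x] that dA by (simp add: charts_at_def dist_commute)
      from zero[OF this] show ?thesis
        by (auto simp: has_mderiv_def o_def intro: has_derivative_at_withinI)
    qed
    then obtain k where "\<forall>x\<in>ball a e. (snd d \<circ> \<delta>) x = k"
      using has_derivative_zero_constant[OF convex_ball] by blast
    then have "snd d (\<delta> x) = snd d (\<delta> a)" if "x \<in> ball a e" for x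
      using that e(1) by simp
    then have eq: "\<delta> x = \<delta> a" if "x \<in> ball a e" for x
      using that e ch by (metis chart_inv_apply centre_in_ball dist_commute mem_ball)
    show "\<exists>T. openin (top_of_set UNIV) T \<and> a \<in> T \<and> (\<forall>x\<in>T. \<delta> x = \<delta> a)"
    proof (intro exI conjI ballI)
      show "openin (top_of_set UNIV) (ball a e)" "a \<in> ball a e"
        using e(1) by simp_all
    qed (rule eq)
  qed
  then show ?thesis
    by (metis UNIV_I constant_on_def)
qed

text \<open>Agreement on an open set passes to the derivatives at its points, so the induction runs
  over all pairs of functions at once.\<close>

lemma Ck_on_cong:
  assumes "open S" "\<And>x. x \<in> S \<Longrightarrow> f x = g x" "Ck_on k S f"
  shows "Ck_on k S g"
  using assms(2,3)
proof (induction k arbitrary: f g)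
  case 0
  then show ?case
    using continuous_on_cong by (metis Ck_on.simps(1))
next
  case (Suc k)
  have der: "(g has_derivative D) (at x)" if "x \<in> S" "(f has_derivative D) (at x)" for x D
    using that Suc.prems(1) assms(1) by (metis has_derivative_transform_within_open)
  have fd: "frechet_derivative f (at x) = frechet_derivative g (at x)" "g differentiable (at x)"
    if "x \<in> S" for x
  proof -
    have "(f has_derivative frechet_derivative f (at x)) (at x)"
      using Suc.prems(2) that frechet_derivative_works by (metis Ck_on.simps(2))
    from der[OF that this] show "frechet_derivative f (at x) = frechet_derivative g (at x)"
      "g differentiable (at x)"
      by (auto simp: differentiable_def intro: frechet_derivative_at)
  qed
  have "Ck_on k S (\<lambda>x. frechet_derivative g (at x) v)" for v
    by (rule Suc.IH[of "\<lambda>x. frechet_derivative f (at x) v"]) (use fd Suc.prems(2) in auto)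
  then show ?case
    using fd by simp
qed

text \<open>The derivative of the rescaled function in direction \<open>v\<close> is the rescaled
  derivative of \<open>f\<close> in direction \<open>t * v\<close>, hence of the same form; this
  keeps the induction going with \<open>f\<close> arbitrary.\<close>

lemma Ck_on_scale:
  fixes f :: "real \<Rightarrow> 'b::real_normed_vector"
  assumes S: "open S" and f: "Ck_on k S f"
  shows "Ck_on k ((*) t -` S) (\<lambda>s. f (t * s))"
  using f
proof (induction k arbitrary: f)
  case 0
  then show ?case
    by (auto intro!: continuous_on_compose2[of S f] continuous_intros)
next
  case (Suc k)
  have der: "((\<lambda>s. f (t * s)) has_derivative (\<lambda>v. frechet_derivative f (at (t * s)) (t * v))) (at s)"
    if "s \<in> (*) t -` S" for s
  proof -
    have "(f has_derivative frechet_derivative f (at (t * s))) (at (t * s))"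
      using Suc.prems that frechet_derivative_works by auto
    moreover have "((*) t has_derivative (*) t) (at s)"
      by (auto intro!: derivative_eq_intros)
    ultimately show ?thesis
      using diff_chain_at[of "(*) t" "(*) t" s f] by (simp add: o_def)
  qed
  have op: "open ((*) t -` S)"
    by (intro open_vimage S continuous_intros)
  have Ck: "Ck_on k ((*) t -` S) (\<lambda>s. frechet_derivative f (at (t * s)) (t * v))" for v
    using Suc.IH[of "\<lambda>x. frechet_derivative f (at x) (t * v)"] Suc.prems by simp
  have "Ck_on k ((*) t -` S) (\<lambda>s. frechet_derivative (\<lambda>s. f (t * s)) (at s) v)" for v
    by (rule Ck_on_cong[OF op _ Ck]) (simp add: frechet_derivative_at[OF der, symmetric])
  then show ?case
    using der by (auto simp: differentiable_def)
qed

lemma Ck_on_const: "Ck_on k S (\<lambda>x. a)"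
  by (induction k arbitrary: a) simp_all

section \<open>Group multiplication, one-parameter subgroups and the exponential map\<close>

lemma lie_groupD:
  assumes "lie_group G AG"
  shows "group G" "smooth_atlas AG" "pre_atlas AG" "mcarrier AG = carrier G"
  using assms by (auto simp: lie_group_def smooth_manifold_def smooth_atlas_imp_pre_atlas)

lemma lie_group_mult_has_mderiv:
  assumes G: "lie_group G AG" and ab: "a \<in> carrier G" "b \<in> carrier G"
    and c: "c \<in> charts_at AG a" "d \<in> charts_at AG b" "e \<in> charts_at AG (a \<otimes>\<^bsub>G\<^esub> b)"
  obtains D where "has_mderiv (prod_chart c d) e (\<lambda>(a, b). a \<otimes>\<^bsub>G\<^esub> b) D (a, b)"
proof -
  have "smooth_map (prod_atlas AG AG) (carrier G \<times> carrier G) AG (\<lambda>(a, b). a \<otimes>\<^bsub>G\<^esub> b)"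
    using G by (simp add: lie_group_def)
  from smooth_map_has_mderiv[OF this, of "(a, b)" "prod_chart c d" e] show thesis
    using that lie_groupD(3)[OF G] ab c
    by (auto simp: pre_atlas_prod prod_chart_in_charts_at)
qed

lemma lie_group_translation_has_mderiv:
  assumes G: "lie_group G AG" and ab: "a \<in> carrier G" "b \<in> carrier G"
    and c: "c \<in> charts_at AG a" and e: "e \<in> charts_at AG (a \<otimes>\<^bsub>G\<^esub> b)"
  shows "\<exists>D. has_mderiv c e (\<lambda>x. x \<otimes>\<^bsub>G\<^esub> b) D a"
proof -
  obtain d where d: "d \<in> charts_at AG b"
    using charts_at_exists ab(2) lie_groupD(4)[OF G] by metis
  obtain D where D: "has_mderiv (prod_chart c d) e (\<lambda>(a, b). a \<otimes>\<^bsub>G\<^esub> b) D (a, b)"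
    using lie_group_mult_has_mderiv[OF G ab c d e] .
  show ?thesis
    using has_mderiv_slice(1)[OF D] charts_atD[OF lie_groupD(3)[OF G]] c d by auto
qed

lemma lie_group_left_translation_has_mderiv:
  assumes G: "lie_group G AG" and ab: "a \<in> carrier G" "b \<in> carrier G"
    and d: "d \<in> charts_at AG b" and e: "e \<in> charts_at AG (a \<otimes>\<^bsub>G\<^esub> b)"
  shows "\<exists>D. has_mderiv d e (\<lambda>x. a \<otimes>\<^bsub>G\<^esub> x) D b"
proof -
  obtain c where c: "c \<in> charts_at AG a"
    using charts_at_exists ab(1) lie_groupD(4)[OF G] by metis
  obtain D where D: "has_mderiv (prod_chart c d) e (\<lambda>(a, b). a \<otimes>\<^bsub>G\<^esub> b) D (a, b)"
    using lie_group_mult_has_mderiv[OF G ab c d e] .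
  show ?thesis
    using has_mderiv_slice(2)[OF D] charts_atD[OF lie_groupD(3)[OF G]] c d by auto
qed

lemma openin_carrier: "lie_group G AG \<Longrightarrow> openin (mtop AG) (carrier G)"
  by (metis lie_groupD(3,4) openin_topspace topspace_mtop_pre_atlas)

text \<open>Each partial derivative is the identity because the unit is two-sided, and the total
  derivative is their sum.\<close>

lemma lie_group_mult_mderiv_one:
  assumes G: "lie_group G AG" and c: "c \<in> charts_at AG \<one>\<^bsub>G\<^esub>"
  shows "has_mderiv (prod_chart c c) c (\<lambda>(a, b). a \<otimes>\<^bsub>G\<^esub> b) (\<lambda>(u, v). u + v) (\<one>\<^bsub>G\<^esub>, \<one>\<^bsub>G\<^esub>)"
proof -
  interpret group G by (rule lie_groupD(1)[OF G])
  note ch = charts_atD[OF lie_groupD(3)[OF G] c]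
  obtain D where D: "has_mderiv (prod_chart c c) c (\<lambda>(a, b). a \<otimes>\<^bsub>G\<^esub> b) D (\<one>\<^bsub>G\<^esub>, \<one>\<^bsub>G\<^esub>)"
    using lie_group_mult_has_mderiv[OF G, of "\<one>\<^bsub>G\<^esub>" "\<one>\<^bsub>G\<^esub>" c c c] c by auto
  have left: "D (u, 0) = u" for u
    by (rule has_mderiv_ident_unique[OF has_mderiv_slice(1)[OF D ch(1,1,2,2)]
          lie_groupD(3)[OF G] c openin_carrier[OF G]]) auto
  have right: "D (0, v) = v" for v
    by (rule has_mderiv_ident_unique[OF has_mderiv_slice(2)[OF D ch(1,1,2,2)]
          lie_groupD(3)[OF G] c openin_carrier[OF G]]) auto
  have "D (u, v) = u + v" for u v
    using has_mderiv_prod_split[OF D, of u v] by (simp only: left right)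
  then have "D = (\<lambda>(u, v). u + v)"
    by auto
  then show ?thesis
    using D by simp
qed

lemma one_parameter_subgroup_props:
  assumes G: "lie_group G AG" and \<gamma>: "one_parameter_subgroup G AG \<gamma>"
  shows "\<gamma> t \<in> carrier G" "\<gamma> 0 = \<one>\<^bsub>G\<^esub>" "\<gamma> (s + t) = \<gamma> s \<otimes>\<^bsub>G\<^esub> \<gamma> t"
proof -
  interpret group G by (rule lie_groupD(1)[OF G])
  show mem: "\<gamma> t \<in> carrier G" for t
    using smooth_map_mem(1)[of real_atlas UNIV AG \<gamma> t] \<gamma> lie_groupD(3,4)[OF G] pre_atlas_real_atlas
    by (auto simp: one_parameter_subgroup_def)
  show hom: "\<gamma> (s + t) = \<gamma> s \<otimes>\<^bsub>G\<^esub> \<gamma> t" for s t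
    using \<gamma> by (simp add: one_parameter_subgroup_def)
  show "\<gamma> 0 = \<one>\<^bsub>G\<^esub>"
    using hom[of 0 0] mem[of 0] l_cancel_one by fastforce
qed

lemma one_parameter_subgroup_has_mderiv:
  assumes G: "lie_group G AG" and \<gamma>: "one_parameter_subgroup G AG \<gamma>" and c: "c \<in> charts_at AG (\<gamma> t)"
  obtains D where "has_mderiv id_chart c \<gamma> D t"
proof -
  have "id_chart \<in> charts_at real_atlas t"
    by (simp add: charts_at_def real_atlas_eq)
  then show thesis
    using smooth_map_has_mderiv[of real_atlas UNIV AG \<gamma> t id_chart c] that \<gamma> c
      lie_groupD(3)[OF G] pre_atlas_real_atlas
    by (auto simp: one_parameter_subgroup_def)
qed

text \<open>Needed to evaluate the definite description in \<open>lie_exp\<close>. The product of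
  the first curve with the inverse of the second has derivative zero at 0, translations carry this
  to every time, and so the product is constantly the unit.\<close>

lemma one_parameter_subgroup_unique:
  assumes G: "lie_group G AG"
    and \<gamma>: "one_parameter_subgroup G AG \<gamma>\<^sub>1" "one_parameter_subgroup G AG \<gamma>\<^sub>2"
    and vel: "velocity AG \<gamma>\<^sub>1 0 = velocity AG \<gamma>\<^sub>2 0"
  shows "\<gamma>\<^sub>1 = \<gamma>\<^sub>2"
proof -
  interpret group G by (rule lie_groupD(1)[OF G])
  note sA = lie_groupD(2)[OF G] and pA = lie_groupD(3)[OF G] and mc = lie_groupD(4)[OF G]
  note p1 = one_parameter_subgroup_props[OF G \<gamma>(1)] and p2 = one_parameter_subgroup_props[OF G \<gamma>(2)]
  define \<delta> where "\<delta> t = \<gamma>\<^sub>1 t \<otimes>\<^bsub>G\<^esub> \<gamma>\<^sub>2 (- t)" for t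
  have mem: "\<delta> t \<in> carrier G" for t
    by (simp add: \<delta>_def p1 p2)
  obtain c where c: "c \<in> charts_at AG \<one>\<^bsub>G\<^esub>"
    using charts_at_exists mc one_closed by metis
  obtain D1 where D1: "has_mderiv id_chart c \<gamma>\<^sub>1 D1 0"
    using one_parameter_subgroup_has_mderiv[OF G \<gamma>(1), of c 0] c p1(2) by auto
  obtain D2 where D2: "has_mderiv id_chart c \<gamma>\<^sub>2 D2 0"
    using one_parameter_subgroup_has_mderiv[OF G \<gamma>(2), of c 0] c p2(2) by auto
  have "D1 1 = D2 1"
    using vel velocity_eq_tvec[OF sA D1] velocity_eq_tvec[OF sA D2] c p1(2) p2(2)
    by (metis sA snd_tvec_same)
  then have D12: "D1 t = D2 t" for t
    by (metis D1 D2 has_mderiv_real_eq_scaleR)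
  have neg: "has_mderiv id_chart id_chart uminus uminus (0::real)"
    by (rule has_mderiv_linear) (rule bounded_linear_minus[OF bounded_linear_ident])
  have "has_mderiv id_chart c (\<lambda>t. \<gamma>\<^sub>2 (- t)) (\<lambda>x. D2 (- x)) 0"
    using has_mderiv_compose[OF neg, of c \<gamma>\<^sub>2 D2] D2 by simp
  from has_mderiv_compose[OF has_mderiv_Pair[OF D1 this], of c "\<lambda>(a, b). a \<otimes>\<^bsub>G\<^esub> b" "\<lambda>(u, v). u + v"]
  have "has_mderiv id_chart c \<delta> (\<lambda>x. D1 x + D2 (- x)) 0"
    using lie_group_mult_mderiv_one[OF G c] by (simp add: p1 p2 \<delta>_def[abs_def])
  moreover have "D1 x + D2 (- x) = 0" for x
    using linear_neg[OF bounded_linear.linear[OF has_mderiv_bounded_linear[OF D2]], of x] by (simp add: D12)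
  ultimately have \<delta>0: "has_mderiv id_chart c \<delta> (\<lambda>x. 0) 0"
    by simp
  \<comment> \<open>Expresses \<delta> near time s through \<delta> near time 0 and two fixed
    translations, whose derivatives send 0 to 0.\<close>
  have \<delta>_add: "\<delta> t = (\<gamma>\<^sub>1 s \<otimes>\<^bsub>G\<^esub> \<delta> (t - s)) \<otimes>\<^bsub>G\<^esub> \<gamma>\<^sub>2 (- s)" for s t
    using p1(3)[of s "t - s"] p2(3)[of "s - t" "- s"] p1(1) p2(1)
    by (simp add: \<delta>_def m_assoc)
  have "\<delta> t = \<delta> 0" for t
  proof (rule constant_if_mderiv_zero[of \<delta> AG])
    fix s d assume d: "d \<in> charts_at AG (\<delta> s)"
    have one: "\<delta> 0 = \<one>\<^bsub>G\<^esub>"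
      by (simp add: \<delta>_def p1 p2)
    obtain e where e: "e \<in> charts_at AG (\<gamma>\<^sub>1 s)"
      using charts_at_exists mc p1(1) by metis
    have d': "d \<in> charts_at AG (\<gamma>\<^sub>1 s \<otimes>\<^bsub>G\<^esub> \<gamma>\<^sub>2 (- s))"
      using d by (simp add: \<delta>_def)
    obtain E1 where E1: "has_mderiv c e (\<lambda>x. \<gamma>\<^sub>1 s \<otimes>\<^bsub>G\<^esub> x) E1 \<one>\<^bsub>G\<^esub>"
      using lie_group_left_translation_has_mderiv[OF G p1(1)[of s] one_closed c, of e] e p1(1) by auto
    obtain E2 where E2: "has_mderiv e d (\<lambda>x. x \<otimes>\<^bsub>G\<^esub> \<gamma>\<^sub>2 (- s)) E2 (\<gamma>\<^sub>1 s)"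
      using lie_group_translation_has_mderiv[OF G p1(1)[of s] p2(1)[of "- s"] e d'] by auto
    have shift: "has_mderiv id_chart id_chart (\<lambda>t. t - s) (\<lambda>v. v) s"
      unfolding has_mderiv_id_chart by (auto intro!: derivative_eq_intros)
    have "has_mderiv id_chart c (\<lambda>t. \<delta> (t - s)) (\<lambda>x. 0) s"
      using has_mderiv_compose[OF shift, of c \<delta> "\<lambda>x. 0"] \<delta>0 by simp
    from has_mderiv_compose[OF this, of e "\<lambda>x. \<gamma>\<^sub>1 s \<otimes>\<^bsub>G\<^esub> x" E1]
    have "has_mderiv id_chart e (\<lambda>t. \<gamma>\<^sub>1 s \<otimes>\<^bsub>G\<^esub> \<delta> (t - s)) (\<lambda>x. E1 0) s"
      using E1 one by simp
    from has_mderiv_compose[OF this, of d "\<lambda>x. x \<otimes>\<^bsub>G\<^esub> \<gamma>\<^sub>2 (- s)" E2]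
    have "has_mderiv id_chart d (\<lambda>t. (\<gamma>\<^sub>1 s \<otimes>\<^bsub>G\<^esub> \<delta> (t - s)) \<otimes>\<^bsub>G\<^esub> \<gamma>\<^sub>2 (- s)) (\<lambda>x. E2 (E1 0)) s"
      using E2 one p1(1) by simp
    moreover have "E2 (E1 0) = 0"
      using has_mderiv_bounded_linear[OF E1] has_mderiv_bounded_linear[OF E2]
      by (simp add: bounded_linear.linear linear_0)
    ultimately show "has_mderiv id_chart d \<delta> (\<lambda>x. 0) s"
      by (simp flip: \<delta>_add)
  qed (simp add: mc mem)
  then have "\<gamma>\<^sub>1 t \<otimes>\<^bsub>G\<^esub> \<gamma>\<^sub>2 (- t) = \<one>\<^bsub>G\<^esub>" for t
    by (simp add: \<delta>_def p1 p2)
  moreover have "\<gamma>\<^sub>2 t \<otimes>\<^bsub>G\<^esub> \<gamma>\<^sub>2 (- t) = \<one>\<^bsub>G\<^esub>" for t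
    using p2(3)[of t "- t"] p2(2) by simp
  ultimately have "\<gamma>\<^sub>1 t = \<gamma>\<^sub>2 t" for t
    using p1(1) p2(1) by (metis right_cancel)
  then show ?thesis
    by blast
qed

text \<open>Time rescaling realises every multiple of a velocity already realised. This evaluates
  \<open>lie_exp\<close> along a line, and in the existence argument below it turns a subgroup for a
  nonzero multiple into one for the vector itself.\<close>

lemma one_parameter_subgroup_scale:
  assumes G: "lie_group G AG" and \<gamma>: "one_parameter_subgroup G AG \<gamma>"
  shows "one_parameter_subgroup G AG (\<lambda>s. \<gamma> (t * s))"
    and "velocity AG (\<lambda>s. \<gamma> (t * s)) 0 = tscale t (velocity AG \<gamma> 0)"
proof -
  note sA = lie_groupD(2)[OF G] and pA = lie_groupD(3)[OF G] and mc = lie_groupD(4)[OF G]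
  have sm: "smooth_map real_atlas UNIV AG \<gamma>"
    using \<gamma> by (simp add: one_parameter_subgroup_def)
  have "continuous_map euclidean (mtop AG) (\<gamma> \<circ> (*) t)"
    using sm by (intro continuous_map_compose[of euclidean euclidean])
      (auto simp: smooth_map_def mtop_real_atlas intro!: continuous_intros)
  moreover have "smooth_on {s. \<gamma> (t * s) \<in> fst d} (snd d \<circ> (\<lambda>s. \<gamma> (t * s)) \<circ> chart_inv id_chart)"
    if d: "d \<in> AG" for d
  proof -
    have "open {s. \<gamma> s \<in> fst d}"
      using smooth_map_open_preimage[OF sm pre_atlas_real_atlas pA, of id_chart d] d
      by (simp add: real_atlas_eq id_chart_def vimage_def)
    moreover have "smooth_on {s. \<gamma> s \<in> fst d} (\<lambda>s. snd d (\<gamma> s))"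
      using sm d by (simp add: smooth_map_def real_atlas_eq o_def) (simp add: id_chart_def vimage_def)
    ultimately show ?thesis
      using Ck_on_scale[of "{s. \<gamma> s \<in> fst d}" _ "\<lambda>s. snd d (\<gamma> s)" t]
      by (simp add: smooth_on_def vimage_def o_def)
  qed
  ultimately have "smooth_map real_atlas UNIV AG (\<lambda>s. \<gamma> (t * s))"
    unfolding smooth_map_def mtop_real_atlas
    by (simp add: real_atlas_eq o_def) (simp add: id_chart_def vimage_def)
  then show "one_parameter_subgroup G AG (\<lambda>s. \<gamma> (t * s))"
    using one_parameter_subgroup_props(3)[OF G \<gamma>]
    by (simp add: one_parameter_subgroup_def distrib_left)
  obtain c where c: "c \<in> charts_at AG (\<gamma> 0)"
    using charts_at_exists mc one_parameter_subgroup_props(1)[OF G \<gamma>] by metis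
  obtain D where D: "has_mderiv id_chart c \<gamma> D 0"
    using one_parameter_subgroup_has_mderiv[OF G \<gamma> c] .
  have "has_mderiv id_chart id_chart ((*) t) ((*) t) 0"
    by (rule has_mderiv_linear) (rule bounded_linear_mult_right)
  from has_mderiv_compose[OF this, of c \<gamma> D]
  have tD: "has_mderiv id_chart c (\<lambda>s. \<gamma> (t * s)) (\<lambda>x. D (t * x)) 0"
    using D by simp
  have *: "velocity AG (\<lambda>s. \<gamma> (t * s)) 0 = tvec AG (\<gamma> 0) c (D t)"
    using velocity_eq_tvec[OF sA tD] c by simp
  have **: "velocity AG \<gamma> 0 = tvec AG (\<gamma> 0) c (D 1)"
    by (rule velocity_eq_tvec[OF sA D c])
  show "velocity AG (\<lambda>s. \<gamma> (t * s)) 0 = tscale t (velocity AG \<gamma> 0)"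
    unfolding * **
    by (rule tspace_eqI[OF tvec_mem_tspace[OF sA c] tscale_mem_tspace[OF sA tvec_mem_tspace[OF sA c]] c])
      (use sA c has_mderiv_real_eq_scaleR[OF D, of t] in \<open>simp add: tscale_def\<close>)
qed

lemma trivial_one_parameter_subgroup:
  assumes G: "lie_group G AG"
  shows "one_parameter_subgroup G AG (\<lambda>t. \<one>\<^bsub>G\<^esub>)" "velocity AG (\<lambda>t. \<one>\<^bsub>G\<^esub>) 0 = tzero \<one>\<^bsub>G\<^esub>"
proof -
  interpret group G by (rule lie_groupD(1)[OF G])
  have "\<one>\<^bsub>G\<^esub> \<in> topspace (mtop AG)"
    using topspace_mtop_pre_atlas lie_groupD(3,4)[OF G] by auto
  then show "one_parameter_subgroup G AG (\<lambda>t. \<one>\<^bsub>G\<^esub>)"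
    by (auto simp: one_parameter_subgroup_def smooth_map_def mtop_real_atlas smooth_on_def o_def Ck_on_const)
  show "velocity AG (\<lambda>t. \<one>\<^bsub>G\<^esub>) 0 = tzero \<one>\<^bsub>G\<^esub>"
    by (auto simp: velocity_def tzero_def o_def)
qed

text \<open>
  No ordinary differential equation has to be solved: if no one-parameter subgroup had velocity \<open>\<xi>\<close>,
  then none would have velocity \<open>t \<xi>\<close> for \<open>t \<noteq> 0\<close>, hence \<open>lie_exp\<close> would take the same junk value at
  all these vectors. So \<open>\<xi>\<close> and \<open>2 \<xi>\<close> would have the same infinitesimal generator, and as \<open>\<A>\<close>
  recovers a vector from its generator, \<open>\<xi>\<close> would be zero.
\<close>

lemma connection_form_imp_one_parameter_subgroup:
  assumes G: "lie_group G AG" and A: "connection_form G AG AQ l \<A>" and q: "q \<in> mcarrier AQ"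
    and \<xi>: "\<xi> \<in> lie_algebra G AG"
  obtains \<gamma> where "one_parameter_subgroup G AG \<gamma>" "velocity AG \<gamma> 0 = \<xi>"
proof (rule ccontr)
  note sA = lie_groupD(2)[OF G]
  assume "\<not> thesis"
  then have none: "\<not> (one_parameter_subgroup G AG \<gamma> \<and> velocity AG \<gamma> 0 = \<xi>)" for \<gamma>
    using that by blast
  have none': "\<not> (one_parameter_subgroup G AG \<gamma> \<and> velocity AG \<gamma> 0 = tscale t \<xi>)" if "t \<noteq> 0" for \<gamma> t
    using none[of "\<lambda>s. \<gamma> (1 / t * s)"] one_parameter_subgroup_scale[OF G, of \<gamma> "1 / t"] that
    by (auto simp: tscale_def)
  have "lie_exp G AG (tscale t \<xi>) = (THE \<gamma>::real \<Rightarrow> 'a. False) 1" if "t \<noteq> 0" for t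
  proof -
    have "(\<lambda>\<gamma>. one_parameter_subgroup G AG \<gamma> \<and> velocity AG \<gamma> 0 = tscale t \<xi>) = (\<lambda>\<gamma>. False)"
      using none'[OF that] by blast
    then show ?thesis
      by (simp only: lie_exp_def)
  qed
  moreover have "tscale t (tscale 2 \<xi>) = tscale (2 * t) \<xi>" for t
    by (simp add: tscale_def mult.commute)
  \<comment> \<open>For \<open>t = 0\<close> both arguments are the zero vector; for all other
    \<open>t\<close> both sides are the same unspecified value. Hence the two curves agree at every
    time, not just near 0.\<close>
  ultimately have "lie_exp G AG (tscale t \<xi>) = lie_exp G AG (tscale t (tscale 2 \<xi>))" for t
    by (cases "t = 0") simp_all
  then have "inf_gen G AG AQ l \<xi> q = inf_gen G AG AQ l (tscale 2 \<xi>) q"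
    by (simp add: inf_gen_def)
  moreover have "tscale 2 \<xi> \<in> lie_algebra G AG"
    using \<xi> tscale_mem_tspace[OF sA] by (simp add: lie_algebra_def)
  ultimately have eq: "\<xi> = tscale 2 \<xi>"
    using A q \<xi> unfolding connection_form_def by metis
  have "snd \<xi> c = 0" for c
    using arg_cong[OF eq, of "\<lambda>v. snd v c"] by (simp add: tscale_def scaleR_2)
  moreover have "fst \<xi> = \<one>\<^bsub>G\<^esub>"
    using \<xi> by (simp add: lie_algebra_def tspace_fst)
  ultimately have "\<xi> = tzero \<one>\<^bsub>G\<^esub>"
    by (auto simp: tzero_def intro!: prod_eqI)
  then show False
    using none trivial_one_parameter_subgroup[OF G] by blast
qed

text \<open>The rescaled curve satisfies the description in \<open>lie_exp\<close>, uniqueness makes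
  it the only one, and its value at time 1 is \<open>\<gamma> t\<close>.\<close>

lemma lie_exp_tscale:
  assumes G: "lie_group G AG" and \<gamma>: "one_parameter_subgroup G AG \<gamma>"
  shows "lie_exp G AG (tscale t (velocity AG \<gamma> 0)) = \<gamma> t"
proof -
  have "(THE \<delta>. one_parameter_subgroup G AG \<delta> \<and> velocity AG \<delta> 0 = tscale t (velocity AG \<gamma> 0)) =
      (\<lambda>s. \<gamma> (t * s))"
    by (rule the_equality) (use one_parameter_subgroup_scale[OF G \<gamma>] one_parameter_subgroup_unique[OF G] in auto)
  then show ?thesis
    by (simp add: lie_exp_def)
qed

text \<open>With \<gamma> a one-parameter subgroup of velocity \<xi>, supplied by the connection
  form, the curve defining the generator is the orbit map along \<gamma>. The chain rule then gives
  the orbit derivative applied to \<xi>.\<close>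

lemma inf_gen_eq_tvec:
  assumes G: "lie_group G AG" and A: "connection_form G AG AQ l \<A>"
    and Q: "smooth_atlas AQ" and q: "q \<in> mcarrier AQ" "l \<one>\<^bsub>G\<^esub> q = q"
    and \<xi>: "\<xi> \<in> lie_algebra G AG" and c: "c \<in> charts_at AG \<one>\<^bsub>G\<^esub>" and d: "d \<in> charts_at AQ q"
    and O: "has_mderiv c d (\<lambda>g. l g q) O' \<one>\<^bsub>G\<^esub>"
  shows "inf_gen G AG AQ l \<xi> q = tvec AQ q d (O' (snd \<xi> c))"
proof -
  note sA = lie_groupD(2)[OF G]
  obtain \<gamma> where \<gamma>: "one_parameter_subgroup G AG \<gamma>" "velocity AG \<gamma> 0 = \<xi>"
    using connection_form_imp_one_parameter_subgroup[OF G A q(1) \<xi>] .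
  note \<gamma>0 = one_parameter_subgroup_props(2)[OF G \<gamma>(1)]
  obtain E where E: "has_mderiv id_chart c \<gamma> E 0"
    using one_parameter_subgroup_has_mderiv[OF G \<gamma>(1), of c 0] c \<gamma>0 by auto
  have "snd \<xi> c = E 1"
    using \<gamma>(2) velocity_eq_tvec[OF sA E] c sA \<gamma>0 by auto
  moreover have "inf_gen G AG AQ l \<xi> q = velocity AQ (\<lambda>t. l (\<gamma> t) q) 0"
    using lie_exp_tscale[OF G \<gamma>(1)] by (simp add: inf_gen_def \<gamma>(2))
  moreover have "has_mderiv id_chart d (\<lambda>t. l (\<gamma> t) q) (\<lambda>x. O' (E x)) 0"
    using has_mderiv_compose[OF E, of d "\<lambda>g. l g q" O'] O \<gamma>0 by simp
  ultimately show ?thesis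
    using velocity_eq_tvec[OF Q, of d "\<lambda>t. l (\<gamma> t) q"] d q(2) \<gamma>0 by fastforce
qed

section \<open>Horizontal lifts\<close>

text \<open>Differentiating along the ray through \<open>x\<close> shows that
  \<open>L x = D x\<close>. So continuity of a linear map follows from differentiability at 0
  alone.\<close>

lemma linear_has_derivative_imp_bounded_linear:
  assumes L: "linear L" and D: "(L has_derivative D) (at 0)"
  shows "bounded_linear L"
proof -
  have "L x = D x" for x
  proof -
    have s: "((\<lambda>t::real. t *\<^sub>R x) has_derivative (\<lambda>t. t *\<^sub>R x)) (at 0)"
      by (auto intro!: derivative_eq_intros)
    have "((\<lambda>t. L (t *\<^sub>R x)) has_derivative (\<lambda>t. D (t *\<^sub>R x))) (at (0::real))"
      using diff_chain_at[OF s, of L D] D by (simp add: o_def)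
    moreover have "((\<lambda>t. L (t *\<^sub>R x)) has_derivative (\<lambda>t. t *\<^sub>R L x)) (at (0::real))"
      by (simp add: linear_scale[OF L]) (auto intro!: derivative_eq_intros)
    ultimately have "(\<lambda>t. D (t *\<^sub>R x)) = (\<lambda>t. t *\<^sub>R L x)"
      by (rule has_derivative_unique)
    from fun_cong[OF this, of 1] show ?thesis
      by simp
  qed
  then have "L = D"
    by blast
  then show ?thesis
    using has_derivative_bounded_linear[OF D] by simp
qed

section \<open>The action, trivialisations and vertical vectors\<close>

lemma principal_bundleD:
  assumes "principal_bundle G AG AQ AM l \<phi>"
  shows "lie_group G AG" "smooth_manifold AQ" "smooth_manifold AM"
    "smooth_atlas AQ" "smooth_atlas AM" "pre_atlas AQ" "pre_atlas AM"
    "group_action G (mcarrier AQ) l"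
    "smooth_map (prod_atlas AG AQ) (carrier G \<times> mcarrier AQ) AQ (\<lambda>(g, q). l g q)"
    "smooth_map AQ (mcarrier AQ) AM \<phi>"
  using assms
  by (auto simp: principal_bundle_def smooth_manifold_def smooth_atlas_imp_pre_atlas)

lemma principal_bundle_action:
  assumes PB: "principal_bundle G AG AQ AM l \<phi>" and q: "q \<in> mcarrier AQ"
  shows "l \<one>\<^bsub>G\<^esub> q = q"
    and "g \<in> carrier G \<Longrightarrow> l g q \<in> mcarrier AQ"
    and "g \<in> carrier G \<Longrightarrow> g' \<in> carrier G \<Longrightarrow> l (g \<otimes>\<^bsub>G\<^esub> g') q = l g (l g' q)"
proof -
  interpret group_action G "mcarrier AQ" l
    by (rule principal_bundleD(8)[OF PB])
  show "l \<one>\<^bsub>G\<^esub> q = q"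
    using id_eq_one q by (metis restrict_apply')
  show "g \<in> carrier G \<Longrightarrow> l g q \<in> mcarrier AQ"
    using element_image q by blast
  show "g \<in> carrier G \<Longrightarrow> g' \<in> carrier G \<Longrightarrow> l (g \<otimes>\<^bsub>G\<^esub> g') q = l g (l g' q)"
    using composition_rule q by blast
qed

text \<open>The partial derivative in the point is the identity because the unit acts trivially; the
  one in the group variable is the derivative \<open>O'\<close> of the orbit map.\<close>

lemma action_has_mderiv:
  assumes PB: "principal_bundle G AG AQ AM l \<phi>" and q: "q \<in> mcarrier AQ"
    and c: "c \<in> charts_at AQ q" and cG: "cG \<in> charts_at AG \<one>\<^bsub>G\<^esub>"
  obtains O' where "has_mderiv (prod_chart cG c) c (\<lambda>(g, q). l g q) (\<lambda>(y, x). O' y + x) (\<one>\<^bsub>G\<^esub>, q)"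
    and "has_mderiv cG c (\<lambda>g. l g q) O' \<one>\<^bsub>G\<^esub>"
proof -
  note G = principal_bundleD(1)[OF PB] and pQ = principal_bundleD(6)[OF PB]
  note act = principal_bundle_action(1)[OF PB]
  interpret group G by (rule lie_groupD(1)[OF G])
  obtain L where L: "has_mderiv (prod_chart cG c) c (\<lambda>(g, q). l g q) L (\<one>\<^bsub>G\<^esub>, q)"
    using smooth_map_has_mderiv[OF principal_bundleD(9)[OF PB], of "(\<one>\<^bsub>G\<^esub>, q)" "prod_chart cG c" c]
      pQ lie_groupD(3)[OF G] q c cG act[OF q]
    by (auto simp: pre_atlas_prod prod_chart_in_charts_at)
  note sl = has_mderiv_slice[OF L charts_atD(1)[OF lie_groupD(3)[OF G] cG] charts_atD(1)[OF pQ c]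
      charts_atD(2)[OF lie_groupD(3)[OF G] cG] charts_atD(2)[OF pQ c]]
  have op: "openin (mtop AQ) (mcarrier AQ)"
    using principal_bundleD(10)[OF PB] by (simp add: smooth_map_def)
  define O' where "O' y = L (y, 0)" for y
  have "L (0, x) = x" for x
    by (rule has_mderiv_ident_unique[OF sl(2) pQ c op q]) (simp add: act)
  then have "L (y, x) = O' y + x" for y x
    using has_mderiv_prod_split[OF L, of y x] by (simp only: O'_def)
  then have "L = (\<lambda>(y, x). O' y + x)"
    by auto
  then show thesis
    using that[of O'] L sl(1) by (simp flip: O'_def)
qed

text \<open>
  The definition of a principal bundle does not force \<open>\<phi>\<close> to be invariant under all of \<open>G\<close>
  (trivialisations are junk outside their domain), so the orbit map is compared with the fibre of the
  trivialisation only near \<open>q\<close>.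
\<close>

lemma principal_bundle_split:
  assumes PB: "principal_bundle G AG AQ AM l \<phi>" and q: "q \<in> mcarrier AQ"
    and c: "c \<in> charts_at AQ q" and cM: "cM \<in> charts_at AM (\<phi> q)" and cG: "cG \<in> charts_at AG \<one>\<^bsub>G\<^esub>"
    and P: "has_mderiv c cM \<phi> P q" and O: "has_mderiv cG c (\<lambda>g. l g q) O' \<one>\<^bsub>G\<^esub>"
  obtains \<sigma> where "bounded_linear \<sigma>" "\<And>u. P (\<sigma> u) = u" "\<And>x. P x = 0 \<Longrightarrow> \<exists>y. x = O' y"
proof -
  note G = principal_bundleD(1)[OF PB] and pQ = principal_bundleD(6)[OF PB]
    and pM = principal_bundleD(7)[OF PB]
  note pG = lie_groupD(3)[OF G] and act = principal_bundle_action[OF PB]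
  interpret group G by (rule lie_groupD(1)[OF G])
  have "\<phi> q \<in> mcarrier AM"
    using smooth_map_mem(1)[OF principal_bundleD(10)[OF PB] pQ pM q] .
  then obtain V \<Psi> where V: "openin (mtop AM) V" "\<phi> q \<in> V"
    and dif: "diffeo AQ {q \<in> mcarrier AQ. \<phi> q \<in> V} (prod_atlas AM AG) (V \<times> carrier G) \<Psi>"
    and triv: "\<forall>q\<in>mcarrier AQ. \<phi> q \<in> V \<longrightarrow> fst (\<Psi> q) = \<phi> q \<and>
      (\<forall>g\<in>carrier G. \<Psi> (l g q) = (\<phi> q, g \<otimes>\<^bsub>G\<^esub> snd (\<Psi> q)))"
    using PB unfolding principal_bundle_def by blast
  have \<Psi>: "fst (\<Psi> q) = \<phi> q" "g \<in> carrier G \<Longrightarrow> \<Psi> (l g q) = (\<phi> q, g \<otimes>\<^bsub>G\<^esub> snd (\<Psi> q))"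
    if "q \<in> mcarrier AQ" "\<phi> q \<in> V" for q g
    using triv that by blast+
  define S where "S = {q \<in> mcarrier AQ. \<phi> q \<in> V}"
  define \<Phi> where "\<Phi> = inv_into S \<Psi>"
  define g0 where "g0 = snd (\<Psi> q)"
  have qS: "q \<in> S"
    using q V by (simp add: S_def)
  have bij: "bij_betw \<Psi> S (V \<times> carrier G)" and sm: "smooth_map AQ S (prod_atlas AM AG) \<Psi>"
    and sm': "smooth_map (prod_atlas AM AG) (V \<times> carrier G) AQ \<Phi>"
    using dif by (simp_all add: diffeo_def S_def \<Phi>_def)
  have \<Psi>q: "\<Psi> q = (\<phi> q, g0)" "g0 \<in> carrier G"
    using \<Psi>(1)[OF q V(2)] bij_betwE[OF bij] qS by (auto simp: g0_def prod_eq_iff mem_Times_iff)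
  have \<Phi>\<Psi>: "\<Phi> (\<Psi> x) = x" if "x \<in> S" for x
    using that bij by (simp add: \<Phi>_def bij_betw_def)
  have \<Psi>\<Phi>: "\<Psi> (\<Phi> y) = y" if "y \<in> V \<times> carrier G" for y
    using that bij unfolding \<Phi>_def by (rule bij_betw_inv_into_right[rotated])
  have opS: "openin (mtop AQ) S"
    and opV: "openin (mtop (prod_atlas AM AG)) (V \<times> carrier G)"
    using sm sm' by (simp_all add: smooth_map_def)
  obtain c0 where c0: "c0 \<in> charts_at AG g0"
    using charts_at_exists lie_groupD(4)[OF G] \<Psi>q(2) by metis
  let ?pc = "prod_chart cM c0"
  have pc: "?pc \<in> charts_at (prod_atlas AM AG) (\<phi> q, g0)"
    by (rule prod_chart_in_charts_at[OF cM c0])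
  have pMG: "pre_atlas (prod_atlas AM AG)"
    by (rule pre_atlas_prod[OF pM pG])
  obtain D where D: "has_mderiv c ?pc \<Psi> D q"
    using smooth_map_has_mderiv[OF sm pQ pMG qS c] pc \<Psi>q(1) by metis
  have \<Phi>q: "\<Phi> (\<phi> q, g0) = q"
    using \<Phi>\<Psi>[OF qS] \<Psi>q(1) by simp
  obtain E where E: "has_mderiv ?pc c \<Phi> E (\<phi> q, g0)"
    using smooth_map_has_mderiv[OF sm' pMG pQ _ pc, of c] V \<Psi>q(2) c \<Phi>q by auto
  have "has_mderiv c c (\<lambda>x. \<Phi> (\<Psi> x)) (\<lambda>v. E (D v)) q"
    using has_mderiv_compose[OF D, of c \<Phi> E] E \<Psi>q(1) by simp
  then have ED: "E (D v) = v" for v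
    by (rule has_mderiv_ident_unique[OF _ pQ c opS qS \<Phi>\<Psi>])
  have "has_mderiv ?pc ?pc (\<lambda>y. \<Psi> (\<Phi> y)) (\<lambda>v. D (E v)) (\<phi> q, g0)"
    using has_mderiv_compose[OF E, of ?pc \<Psi> D] D \<Phi>q by simp
  then have DE: "D (E v) = v" for v
    by (rule has_mderiv_ident_unique[OF _ pMG pc opV _ \<Psi>\<Phi>]) (use V \<Psi>q in auto)
  have ch: "chart cM" "chart c0" "\<phi> q \<in> fst cM" "g0 \<in> fst c0"
    using charts_atD pM pG cM c0 by metis+
  have "has_mderiv c cM (\<lambda>x. fst (\<Psi> x)) (\<lambda>v. fst (D v)) q"
    using has_mderiv_compose[OF D, of cM fst fst] has_mderiv_fst[OF ch] \<Psi>q(1) by simp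
  then have "has_mderiv c cM \<phi> (\<lambda>v. fst (D v)) q"
    by (rule has_mderiv_cong_open[OF _ pQ c opS qS]) (simp add: S_def \<Psi>(1))
  then have PD: "P = (\<lambda>v. fst (D v))"
    by (rule has_mderiv_unique[OF P])
  \<comment> \<open>\<open>g0\<close> is the group coordinate of \<open>q\<close> in the
    trivialisation. Translation by its inverse moves \<open>g0\<close> to the unit, so the orbit map
    after \<open>?\<rho>\<close> becomes the fibre through \<open>q\<close>, parametrised by its
    group coordinate.\<close>
  let ?\<rho> = "\<lambda>g. g \<otimes>\<^bsub>G\<^esub> inv\<^bsub>G\<^esub> g0"
  obtain N where N: "has_mderiv c0 cG ?\<rho> N g0"
    using lie_group_translation_has_mderiv[OF G \<Psi>q(2) inv_closed[OF \<Psi>q(2)] c0, of cG] cG \<Psi>q(2) by auto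
  have ON: "has_mderiv c0 c (\<lambda>g. l (?\<rho> g) q) (\<lambda>v. O' (N v)) g0"
    using has_mderiv_compose[OF N, of c "\<lambda>g. l g q" O'] O \<Psi>q(2) by simp
  have l1: "l (?\<rho> g0) q = q"
    using \<Psi>q(2) act(1)[OF q] by simp
  have "\<forall>\<^sub>F x in nhds (snd c0 g0). l (?\<rho> (chart_inv c0 x)) q \<in> S"
    using has_mderiv_eventually_mem[OF ON pQ opS] l1 qS c by simp
  moreover have "\<forall>\<^sub>F x in nhds (snd c0 g0). chart_inv c0 x \<in> carrier G"
    by (rule openin_imp_eventually_chart[OF pG openin_carrier[OF G] \<Psi>q(2) c0])
  ultimately have "\<forall>\<^sub>F x in nhds (snd c0 g0). l (?\<rho> (chart_inv c0 x)) q = \<Phi> (\<phi> q, chart_inv c0 x)"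
  proof eventually_elim
    case (elim x)
    let ?g = "chart_inv c0 x"
    have "\<Psi> (l (?\<rho> ?g) q) = (\<phi> q, ?g)"
      using \<Psi>(2)[OF q V(2), of "?\<rho> ?g"] elim(2) \<Psi>q by (simp add: m_assoc)
    then show ?case
      using \<Phi>\<Psi>[OF elim(1)] by simp
  qed
  from has_mderiv_cong[OF ON this]
  have EO: "(\<lambda>v. O' (N v)) = (\<lambda>v. E (0, v))"
    by (rule has_mderiv_unique) (rule has_mderiv_slice(2)[OF E ch])
  \<comment> \<open>The section \<sigma>: lift a base vector through the trivialisation with the
    group coordinate held fixed.\<close>
  have "bounded_linear (\<lambda>u. E (u, 0))"
    by (rule has_mderiv_bounded_linear) (rule has_mderiv_slice(1)[OF E ch])
  moreover have "P (E (u, 0)) = u" for u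
    by (simp add: PD DE)
  moreover have "\<exists>y. x = O' y" if "P x = 0" for x
  proof -
    have "D x = (0, snd (D x))"
      using that by (simp add: PD prod_eq_iff)
    then have "x = E (0, snd (D x))"
      using ED[of x] by simp
    then show ?thesis
      using fun_cong[OF EO, of "snd (D x)"] by metis
  qed
  ultimately show thesis
    by (rule that)
qed

text \<open>The target is hidden in \<open>smooth_map\<close>: a continuous map takes values in the
  topological space of \<open>tspace_atlas\<close>, which consists of Lie algebra elements.\<close>

lemma connection_form_mem:
  assumes G: "lie_group G AG" and Q: "smooth_atlas AQ" and A: "connection_form G AG AQ l \<A>"
    and v: "v \<in> tcarrier AQ"
  shows "\<A> v \<in> tspace AG \<one>\<^bsub>G\<^esub>"
proof -
  interpret group G by (rule lie_groupD(1)[OF G])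
  have "smooth_map (tbundle AQ) (tcarrier AQ) (tspace_atlas AG \<one>\<^bsub>G\<^esub>) \<A>"
    using A by (simp add: connection_form_def)
  from smooth_map_mem(1)[OF this pre_atlas_tbundle[OF Q] pre_atlas_tspace_atlas[OF lie_groupD(2)[OF G]] v]
  show ?thesis
    by (auto simp: mcarrier_def tspace_atlas_eq tspace_chart_def split: if_splits)
qed

text \<open>Linearity on fibres is an axiom of the connection form; boundedness comes from its
  differentiability at the zero vector.\<close>

lemma bounded_linear_connection_coord:
  assumes G: "lie_group G AG" and Q: "smooth_atlas AQ" and A: "connection_form G AG AQ l \<A>"
    and q: "q \<in> mcarrier AQ" and c: "c \<in> charts_at AQ q" and d: "d \<in> charts_at AG \<one>\<^bsub>G\<^esub>"
  shows "bounded_linear (\<lambda>x. snd (\<A> (tvec AQ q c x)) d)"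
proof -
  note sG = lie_groupD(2)[OF G]
  have tv: "tvec AQ q c x \<in> tspace AQ q" for x
    by (rule tvec_mem_tspace[OF Q c])
  have lin: "linear (\<lambda>x. snd (\<A> (tvec AQ q c x)) d)"
  proof (rule linearI)
    fix x y r
    have "tvec AQ q c (x + y) = tadd (tvec AQ q c x) (tvec AQ q c y)"
      by (rule tspace_eqI[OF tv tadd_mem_tspace[OF Q tv tv] c]) (simp add: Q c tadd_def)
    moreover have "tvec AQ q c (r *\<^sub>R x) = tscale r (tvec AQ q c x)"
      by (rule tspace_eqI[OF tv tscale_mem_tspace[OF Q tv] c]) (simp add: Q c tscale_def)
    moreover have "\<A> (tadd (tvec AQ q c x) (tvec AQ q c y)) = tadd (\<A> (tvec AQ q c x)) (\<A> (tvec AQ q c y))"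
      "\<A> (tscale r (tvec AQ q c x)) = tscale r (\<A> (tvec AQ q c x))"
      using A q tv unfolding connection_form_def by blast+
    ultimately show "snd (\<A> (tvec AQ q c (x + y))) d = snd (\<A> (tvec AQ q c x)) d + snd (\<A> (tvec AQ q c y)) d"
      "snd (\<A> (tvec AQ q c (r *\<^sub>R x))) d = r *\<^sub>R snd (\<A> (tvec AQ q c x)) d"
      by (simp_all add: tadd_def tscale_def)
  qed
  let ?w = "tvec AQ q c 0"
  have w: "?w \<in> tcarrier AQ"
    by (rule tspace_subset_tcarrier[OF q tv])
  have "smooth_map (tbundle AQ) (tcarrier AQ) (tspace_atlas AG \<one>\<^bsub>G\<^esub>) \<A>"
    using A by (simp add: connection_form_def)
  moreover have "tspace_chart AG \<one>\<^bsub>G\<^esub> d \<in> charts_at (tspace_atlas AG \<one>\<^bsub>G\<^esub>) (\<A> ?w)"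
    using connection_form_mem[OF G Q A w] d by (auto simp: charts_at_def tspace_atlas_eq tspace_chart_def)
  ultimately obtain D where D: "has_mderiv (tangent_chart AQ c) (tspace_chart AG \<one>\<^bsub>G\<^esub> d) \<A> D ?w"
    using smooth_map_has_mderiv[OF _ pre_atlas_tbundle[OF Q] pre_atlas_tspace_atlas[OF sG] w
        tangent_chart_in_charts_at[OF c tv]] by metis
  have "has_mderiv id_chart (tspace_chart AG \<one>\<^bsub>G\<^esub> d) (\<lambda>x. \<A> (tvec AQ q c x)) (\<lambda>v. D (0, v)) 0"
    by (rule has_mderiv_compose[OF has_mderiv_tvec[OF Q c] D])
  then have "((\<lambda>x. snd (\<A> (tvec AQ q c x)) d) has_derivative (\<lambda>v. D (0, v))) (at 0)"
    by (simp add: has_mderiv_def o_def) (simp add: tspace_chart_def)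
  then show ?thesis
    by (rule linear_has_derivative_imp_bounded_linear[OF lin])
qed

text \<open>The axiom that \<A> recovers a vector from its generator, read in charts: \<A> is a left
  inverse of the orbit derivative.\<close>

lemma connection_coord_orbit:
  assumes PB: "principal_bundle G AG AQ AM l \<phi>" and A: "connection_form G AG AQ l \<A>"
    and q: "q \<in> mcarrier AQ" and c: "c \<in> charts_at AQ q" and d: "d \<in> charts_at AG \<one>\<^bsub>G\<^esub>"
    and O: "has_mderiv d c (\<lambda>g. l g q) O' \<one>\<^bsub>G\<^esub>"
  shows "snd (\<A> (tvec AQ q c (O' y))) d = y"
proof -
  note G = principal_bundleD(1)[OF PB] and Q = principal_bundleD(4)[OF PB]
  note sG = lie_groupD(2)[OF G]
  let ?\<xi> = "tvec AG \<one>\<^bsub>G\<^esub> d y"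
  have \<xi>: "?\<xi> \<in> lie_algebra G AG"
    by (simp add: lie_algebra_def tvec_mem_tspace[OF sG d])
  have "inf_gen G AG AQ l ?\<xi> q = tvec AQ q c (O' y)"
    using inf_gen_eq_tvec[OF G A Q q principal_bundle_action(1)[OF PB q] \<xi> d c O] sG d by simp
  moreover have "\<A> (inf_gen G AG AQ l ?\<xi> q) = ?\<xi>"
    using A q \<xi> unfolding connection_form_def by blast
  ultimately show ?thesis
    using sG d by simp
qed

text \<open>The lift is the section \<sigma> followed by the projection that subtracts the vertical
  part found by \<A>. Since \<A> inverts the orbit derivative, it vanishes on the result.\<close>

lemma horizontal_lift_coord:
  assumes PB: "principal_bundle G AG AQ AM l \<phi>" and A: "connection_form G AG AQ l \<A>"
    and q: "q \<in> mcarrier AQ" and c: "c \<in> charts_at AQ q" and cM: "cM \<in> charts_at AM (\<phi> q)"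
    and cG: "cG \<in> charts_at AG \<one>\<^bsub>G\<^esub>"
  obtains H where "bounded_linear H"
    and "\<And>u. u \<in> tspace AM (\<phi> q) \<Longrightarrow>
      horizontal_lift G AG AQ AM l \<phi> \<A> q u = tvec AQ q c (H (snd u cM))"
    and "\<And>x. snd (\<A> (tvec AQ q c (H x))) cG = 0"
proof -
  note G = principal_bundleD(1)[OF PB] and sQ = principal_bundleD(4)[OF PB]
    and sM = principal_bundleD(5)[OF PB]
  note pQ = principal_bundleD(6)[OF PB] and pM = principal_bundleD(7)[OF PB]
  obtain O' where O: "has_mderiv cG c (\<lambda>g. l g q) O' \<one>\<^bsub>G\<^esub>"
    using action_has_mderiv[OF PB q c cG] by metis
  obtain P where P: "has_mderiv c cM \<phi> P q"
    using smooth_map_has_mderiv[OF principal_bundleD(10)[OF PB] pQ pM q c cM] .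
  obtain \<sigma> where \<sigma>: "bounded_linear \<sigma>" "\<And>u. P (\<sigma> u) = u" "\<And>x. P x = 0 \<Longrightarrow> \<exists>y. x = O' y"
    using principal_bundle_split[OF PB q c cM cG P O] by blast
  define a where "a x = snd (\<A> (tvec AQ q c x)) cG" for x
  have a: "bounded_linear a"
    using bounded_linear_connection_coord[OF G sQ A q c cG] by (simp add: a_def[abs_def])
  have aO: "a (O' y) = y" for y
    unfolding a_def by (rule connection_coord_orbit[OF PB A q c cG O])
  note bO = has_mderiv_bounded_linear[OF O] and bP = has_mderiv_bounded_linear[OF P]
  note lin_a = bounded_linear.linear[OF a] and lin_O = bounded_linear.linear[OF bO]
    and lin_P = bounded_linear.linear[OF bP]
  have tv: "tvec AQ q c x \<in> tspace AQ q" for x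
    by (rule tvec_mem_tspace[OF sQ c])
  define H where "H u = \<sigma> u - O' (a (\<sigma> u))" for u
  have "bounded_linear H"
    unfolding H_def[abs_def]
    by (intro bounded_linear_sub \<sigma>(1) bounded_linear_compose[OF bO] bounded_linear_compose[OF a])
  moreover have "horizontal_lift G AG AQ AM l \<phi> \<A> q u = tvec AQ q c (H (snd u cM))"
    if u: "u \<in> tspace AM (\<phi> q)" for u
  proof -
    have tm: "tmap AQ AM \<phi> v = tvec AM (\<phi> q) cM (P (snd v c))" if "v \<in> tspace AQ q" for v
      by (rule tmap_eq_tvec[OF sQ sM P c cM that])
    define w where "w = (SOME w. w \<in> tspace AQ q \<and> tmap AQ AM \<phi> w = u)"
    have "tmap AQ AM \<phi> (tvec AQ q c (\<sigma> (snd u cM))) = u"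
      using tm[OF tv] sQ c \<sigma>(2) tvec_coord[OF sM cM u] by simp
    then have "\<exists>w. w \<in> tspace AQ q \<and> tmap AQ AM \<phi> w = u"
      using tv by blast
    then have w: "w \<in> tspace AQ q" "tmap AQ AM \<phi> w = u"
      unfolding w_def by (metis (mono_tags, lifting) someI_ex)+
    define x where "x = snd w c"
    have wx: "w = tvec AQ q c x"
      using tvec_coord[OF sQ c w(1)] by (simp add: x_def)
    have "P x = snd u cM"
      using tm[OF w(1)] w(2) sM cM by (auto simp: x_def)
    then have "P (x - \<sigma> (snd u cM)) = 0"
      by (simp add: linear_diff[OF lin_P] \<sigma>(2))
    then obtain y where "x - \<sigma> (snd u cM) = O' y"
      using \<sigma>(3) by blast
    then have xy: "x = \<sigma> (snd u cM) + O' y"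
      by (simp add: algebra_simps)
    \<comment> \<open>Independence of the lift selected by \<open>SOME\<close>: it differs from the
      \<sigma>-lift by a vertical vector \<open>O' y\<close>, and the projection removes it because
      \<open>a (O' y) = y\<close>.\<close>
    have xH: "x - O' (a x) = H (snd u cM)"
      by (simp add: xy H_def linear_add[OF lin_a] linear_add[OF lin_O] aO)
    have Aw: "\<A> w \<in> lie_algebra G AG"
      unfolding lie_algebra_def
      by (rule connection_form_mem[OF G sQ A tspace_subset_tcarrier[OF q w(1)]])
    have "inf_gen G AG AQ l (\<A> w) q = tvec AQ q c (O' (a x))"
      using inf_gen_eq_tvec[OF G A sQ q principal_bundle_action(1)[OF PB q] Aw cG c O]
      by (simp add: a_def wx)
    then have "horizontal_lift G AG AQ AM l \<phi> \<A> q u = tdiff (tvec AQ q c x) (tvec AQ q c (O' (a x)))"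
      by (simp add: horizontal_lift_def Let_def wx flip: w_def)
    also have "\<dots> = tvec AQ q c (x - O' (a x))"
    proof (rule tspace_eqI[OF _ tv c])
      show "tdiff (tvec AQ q c x) (tvec AQ q c (O' (a x))) \<in> tspace AQ q"
        unfolding tdiff_eq by (intro tadd_mem_tspace tscale_mem_tspace sQ tv)
    qed (simp add: tdiff_def sQ c)
    finally show ?thesis
      by (simp add: xH)
  qed
  moreover have "snd (\<A> (tvec AQ q c (H x))) cG = 0" for x
    using linear_diff[OF lin_a, of "\<sigma> x" "O' (a (\<sigma> x))"] by (simp add: aO H_def flip: a_def)
  ultimately show thesis
    by (rule that)
qed

lemma horizontal_lift_tzero:
  assumes PB: "principal_bundle G AG AQ AM l \<phi>" and A: "connection_form G AG AQ l \<A>"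
    and q: "q \<in> mcarrier AQ"
  shows "horizontal_lift G AG AQ AM l \<phi> \<A> q (tzero (\<phi> q)) = tzero q"
proof -
  note G = principal_bundleD(1)[OF PB] and sQ = principal_bundleD(4)[OF PB]
    and sM = principal_bundleD(5)[OF PB]
  interpret group G by (rule lie_groupD(1)[OF G])
  have "\<phi> q \<in> mcarrier AM"
    using smooth_map_mem(1)[OF principal_bundleD(10)[OF PB] principal_bundleD(6,7)[OF PB] q] .
  then obtain c cM cG where c: "c \<in> charts_at AQ q" and cM: "cM \<in> charts_at AM (\<phi> q)"
    and cG: "cG \<in> charts_at AG \<one>\<^bsub>G\<^esub>"
    using charts_at_exists q lie_groupD(4)[OF G] one_closed by metis
  obtain H where H: "bounded_linear H" "\<And>u. u \<in> tspace AM (\<phi> q) \<Longrightarrow>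
      horizontal_lift G AG AQ AM l \<phi> \<A> q u = tvec AQ q c (H (snd u cM))"
    using horizontal_lift_coord[OF PB A q c cM cG] by metis
  have "horizontal_lift G AG AQ AM l \<phi> \<A> q (tzero (\<phi> q)) = tvec AQ q c 0"
    using H(2)[OF tzero_mem_tspace[OF sM]] linear_0[OF bounded_linear.linear[OF H(1)]]
    by (simp add: tzero_def)
  also have "\<dots> = tzero q"
    by (rule tspace_eqI[OF tvec_mem_tspace[OF sQ c] tzero_mem_tspace[OF sQ] c])
      (simp add: sQ c tzero_def)
  finally show ?thesis .
qed

text \<open>The point selected by \<open>SOME\<close> may be any point of the fibre, but the lift of
  the zero vector there is zero, \<open>R\<close> returns that point, and \<phi> forgets which one
  it was.\<close>

lemma reduced_retraction_tzero:
  assumes PB: "principal_bundle G AG AQ AM l \<phi>" and R: "smooth_retraction AQ Z R"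
    and A: "connection_form G AG AQ l \<A>" and q: "q \<in> mcarrier AQ"
  shows "reduced_retraction AQ \<phi> (horizontal_lift G AG AQ AM l \<phi> \<A>) R (tzero (\<phi> q)) = \<phi> q"
proof -
  define q0 where "q0 = (SOME q'. q' \<in> mcarrier AQ \<and> \<phi> q' = \<phi> q)"
  have "q0 \<in> mcarrier AQ \<and> \<phi> q0 = \<phi> q"
    unfolding q0_def by (rule someI[of _ q]) (simp add: q)
  moreover from this have "horizontal_lift G AG AQ AM l \<phi> \<A> q0 (tzero (\<phi> q)) = tzero q0"
    using horizontal_lift_tzero[OF PB A, of q0] by simp
  ultimately show ?thesis
    using R by (simp add: reduced_retraction_def Let_def tzero_def smooth_retraction_def flip: q0_def)
qed

section \<open>The derivative of the discrete connection form at the diagonal\<close>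

theorem corollary4p9:
  fixes G :: "('g, 'x) monoid_scheme"
    and AG :: "('g, 'k::{banach, heine_borel}) atlas"
    and AQ :: "('q, 'e::{banach, heine_borel}) atlas"
    and AM :: "('m, 'f::{banach, heine_borel}) atlas"
    and l :: "'g \<Rightarrow> 'q \<Rightarrow> 'q"
    and \<phi> :: "'q \<Rightarrow> 'm"
    and Z :: "('q, 'e) tangent set"
    and R :: "('q, 'e) tangent \<Rightarrow> 'q"
    and \<A> :: "('q, 'e) tangent \<Rightarrow> ('g, 'k) tangent"
    and h :: "'q \<Rightarrow> ('m, 'f) tangent \<Rightarrow> ('q, 'e) tangent"
    and Rr :: "('m, 'f) tangent \<Rightarrow> 'm"
    and V :: "('m, 'f) tangent set"
    and W :: "('m \<times> 'm) set"
    and U :: "('q \<times> 'q) set"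
    and h\<^sub>d :: "'q \<times> 'm \<Rightarrow> 'q \<times> 'q"
    and \<A>\<^sub>d :: "'q \<times> 'q \<Rightarrow> 'g"
  assumes PB: "principal_bundle G AG AQ AM l \<phi>"
    and R: "equivariant_retraction G AQ l Z R"
    and A: "connection_form G AG AQ l \<A>"
    and h: "h = horizontal_lift G AG AQ AM l \<phi> \<A>"
    and Rr: "Rr = reduced_retraction AQ \<phi> h R"
    and V: "tzero ` mcarrier AM \<subseteq> V" "V \<subseteq> reduced_domain AQ AM \<phi> h Z"
    and W: "\<forall>m\<in>mcarrier AM. (m, m) \<in> W"
    and VW: "diffeo (tbundle AM) V (prod_atlas AM AM) W (extended_retraction Rr)"
    and U: "U = {(q, q') \<in> mcarrier AQ \<times> mcarrier AQ. (\<phi> q, \<phi> q') \<in> W}"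
    and h\<^sub>d: "\<forall>(q, m) \<in> map_prod id \<phi> ` U. h\<^sub>d (q, m) =
          extended_retraction R (h q (inv_into V (extended_retraction Rr) (\<phi> q, m)))"
    and A\<^sub>d: "discrete_connection_form G AG AQ l U \<A>\<^sub>d"
    and corr: "corresponds G AQ l \<phi> U \<A>\<^sub>d h\<^sub>d"
  shows "\<forall>v\<in>tcarrier AQ. derived_connection AG AQ \<A>\<^sub>d v = \<A> v"
proof
  fix v assume v: "v \<in> tcarrier AQ"
  define q where "q = fst v"
  have vq: "v \<in> tspace AQ q"
    using tcarrier_mem_tspace[OF v] by (simp add: q_def)
  have q: "q \<in> mcarrier AQ"
    using v by (auto simp: q_def tcarrier_def tspace_fst)
  note G = principal_bundleD(1)[OF PB] and sQ = principal_bundleD(4)[OF PB]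
    and sM = principal_bundleD(5)[OF PB] and pQ = principal_bundleD(6)[OF PB]
    and pM = principal_bundleD(7)[OF PB]
  note pG = lie_groupD(3)[OF G] and act = principal_bundle_action[OF PB]
  interpret group G by (rule lie_groupD(1)[OF G])
  have sR: "smooth_retraction AQ Z R"
    using R by (simp add: equivariant_retraction_def)
  define m where "m = \<phi> q"
  have m: "m \<in> mcarrier AM"
    using smooth_map_mem(1)[OF principal_bundleD(10)[OF PB] pQ pM q] by (simp add: m_def)
  obtain c cM where c: "c \<in> charts_at AQ q" and cM: "cM \<in> charts_at AM m"
    using charts_at_exists q m by metis
  note chQ = charts_atD[OF pQ c] and chM = charts_atD[OF pM cM]
  define F where "F = extended_retraction Rr"
  define u where "u q' = inv_into V F (m, \<phi> q')" for q'
  define a where "a q' = \<A>\<^sub>d (q, q')" for q'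

  have F: "bij_betw F V W" and Finv: "smooth_map (prod_atlas AM AM) W (tbundle AM) (inv_into V F)"
    using VW by (simp_all add: diffeo_def F_def)
  have "F (tzero m) = (m, m)"
    using reduced_retraction_tzero[OF PB sR A q]
    by (simp add: F_def extended_retraction_def Rr h m_def) (simp add: tzero_def)
  then have invmm: "inv_into V F (m, m) = tzero m"
    using F V(1) m by (metis bij_betw_inv_into_left image_subset_iff)
  have uq: "u q = tzero m"
    by (simp add: u_def invmm flip: m_def)
  \<comment> \<open>The first component of the extended retraction is the base point, so inverting
    it at \<open>(m, _)\<close> always yields vectors at \<open>m\<close>.\<close>
  have u_mem: "u q' \<in> tspace AM m" if "(q, q') \<in> U" for q'
  proof -
    have w: "(m, \<phi> q') \<in> W"
      using that U by (simp add: m_def)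
    then have "u q' \<in> V" and Fu: "F (u q') = (m, \<phi> q')"
      using bij_betw_inv_into_right[OF F w] bij_betwE[OF bij_betw_inv_into[OF F]] by (simp_all add: u_def)
    then have "u q' \<in> tcarrier AM"
      using V(2) by (auto simp: reduced_domain_def)
    moreover have "fst (u q') = m"
      using Fu by (simp add: F_def extended_retraction_def)
    ultimately show ?thesis
      using tcarrier_mem_tspace by metis
  qed

  obtain P where P: "has_mderiv c cM \<phi> P q"
    using smooth_map_has_mderiv[OF principal_bundleD(10)[OF PB] pQ pM q c cM[unfolded m_def]] .
  have "tangent_chart AM cM \<in> charts_at (tbundle AM) (inv_into V F (m, m))"
    unfolding invmm by (rule tangent_chart_in_charts_at[OF cM tzero_mem_tspace[OF sM]])
  \<comment> \<open>The derivative of the inverse stays unspecified. Its output is later fed into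
    \<open>H\<close>, whose values are horizontal in any case.\<close>
  then obtain I where I: "has_mderiv (prod_chart cM cM) (tangent_chart AM cM) (inv_into V F) I (m, m)"
    using smooth_map_has_mderiv[OF Finv pre_atlas_prod[OF pM pM] pre_atlas_tbundle[OF sM]
        bspec[OF W m] prod_chart_in_charts_at[OF cM cM]] by metis
  have "has_mderiv cM (tangent_chart AM cM) (\<lambda>m'. inv_into V F (m, m')) (\<lambda>x. I (0, x)) (\<phi> q)"
    using has_mderiv_slice(2)[OF I chM(1,1,2,2)] by (simp add: m_def)
  from has_mderiv_compose[OF P this]
  have "has_mderiv c (tangent_chart AM cM) u (\<lambda>x. I (0, P x)) q"
    by (simp add: u_def[abs_def])
  from has_mderiv_compose[OF this has_mderiv_coord[OF sM cM]]
  have du: "has_mderiv c id_chart (\<lambda>q'. snd (u q') cM) (\<lambda>x. snd (I (0, P x))) q"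
    using uq tzero_mem_tspace[OF sM] by simp

  have opU: "openin (mtop (prod_atlas AQ AQ)) U"
    and Ad_smooth: "smooth_map (prod_atlas AQ AQ) U AG \<A>\<^sub>d"
    and Ad_diag: "\<A>\<^sub>d (q, q) = \<one>\<^bsub>G\<^esub>" and diag: "(q, q) \<in> U"
    using A\<^sub>d q by (auto simp: discrete_connection_form_def D_type_def)
  have a_mem: "a q' \<in> carrier G" if "(q, q') \<in> U" for q'
    using smooth_map_mem(1)[OF Ad_smooth pre_atlas_prod[OF pQ pQ] pG that] lie_groupD(4)[OF G]
    by (simp add: a_def)

  have aq: "a q = \<one>\<^bsub>G\<^esub>"
    by (simp add: a_def Ad_diag)
  \<comment> \<open>The comparison is made separately in each chart \<open>d\<close> at the unit,
    where the vertical and horizontal parts of \<open>v\<close> can be told apart by the coordinate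
    of \<A>.\<close>
  have coord: "snd (tmap AQ AG a v) d = snd (\<A> v) d" if d: "d \<in> charts_at AG \<one>\<^bsub>G\<^esub>" for d
  proof -
    obtain D where D: "has_mderiv (prod_chart c c) d \<A>\<^sub>d D (q, q)"
      using smooth_map_has_mderiv[OF Ad_smooth pre_atlas_prod[OF pQ pQ] pG diag
          prod_chart_in_charts_at[OF c c]] d Ad_diag by metis
    define Da where "Da x = D (0, x)" for x
    have Da: "has_mderiv c d a Da q"
      using has_mderiv_slice(2)[OF D chQ(1,1,2,2)] by (simp add: a_def[abs_def] Da_def[abs_def])
    obtain H where H: "bounded_linear H"
      "\<And>u. u \<in> tspace AM m \<Longrightarrow> h q u = tvec AQ q c (H (snd u cM))"
      "\<And>x. snd (\<A> (tvec AQ q c (H x))) d = 0"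
      using horizontal_lift_coord[OF PB A q c _ d, of cM] cM by (metis h m_def)
    define s where "s q' = R (tvec AQ q c (H (snd (u q') cM)))" for q'
    define Ds where "Ds x = H (snd (I (0, P x)))" for x
    have H0: "H 0 = 0"
      by (rule linear_0[OF bounded_linear.linear[OF H(1)]])
    have uq0: "snd (u q) cM = 0"
      by (simp add: uq tzero_def)
    have "has_mderiv c id_chart (\<lambda>q'. H (snd (u q') cM)) Ds q"
      unfolding Ds_def[abs_def] by (rule has_mderiv_compose[OF du has_mderiv_linear[OF H(1)]])
    from has_mderiv_compose[OF this, of c "\<lambda>x. R (tvec AQ q c x)" "\<lambda>x. x"]
    have Ds: "has_mderiv c c s Ds q"
      using retraction_coord[OF principal_bundleD(2)[OF PB] sR q c] by (simp add: s_def[abs_def] uq0 H0)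
    have s_eq: "l (a q') (s q') = q'" if q': "(q, q') \<in> U" for q'
    proof -
      have mem: "(q, \<phi> q') \<in> map_prod id \<phi> ` U"
        using q' by force
      have Q: "q' \<in> mcarrier AQ"
        using q' U by auto
      have "h\<^sub>d (q, \<phi> q') = extended_retraction R (h q (u q'))"
        using bspec[OF h\<^sub>d mem] by (simp add: u_def F_def m_def)
      moreover have "h\<^sub>d (q, \<phi> q') = (q, l (inv\<^bsub>G\<^esub> (a q')) q')"
        using corr mem Q by (auto simp: corresponds_def a_def)
      ultimately have "s q' = l (inv\<^bsub>G\<^esub> (a q')) q'"
        using H(2)[OF u_mem[OF q']] by (simp add: extended_retraction_def s_def)
      then show ?thesis
        using act(3)[OF Q a_mem[OF q'] inv_closed[OF a_mem[OF q']]] act(1)[OF Q] a_mem[OF q'] by simp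
    qed
    \<comment> \<open>\<open>Ds\<close> already places \<open>s q\<close> in a chart domain, hence
      in the carrier, where the unit is known to act trivially; \<open>s_eq\<close> at the diagonal
      then yields \<open>s q = q\<close>.\<close>
    have "s q \<in> mcarrier AQ"
      using Ds c by (auto simp: has_mderiv_def charts_at_def mcarrier_def)
    then have sq: "s q = q"
      using s_eq[OF diag] act(1) by (simp add: aq)
    obtain O' where O: "has_mderiv (prod_chart d c) c (\<lambda>(g, q). l g q) (\<lambda>(y, x). O' y + x) (\<one>\<^bsub>G\<^esub>, q)"
      and orb: "has_mderiv d c (\<lambda>g. l g q) O' \<one>\<^bsub>G\<^esub>"
      using action_has_mderiv[OF PB q c d] .
    have prod: "has_mderiv c c (\<lambda>q'. l (a q') (s q')) (\<lambda>x. O' (Da x) + Ds x) q"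
      using has_mderiv_compose[OF has_mderiv_Pair[OF Da Ds], of c "\<lambda>(g, q). l g q" "\<lambda>(y, x). O' y + x"] O sq aq by simp
    \<comment> \<open>Openness of \<open>U\<close> extends \<open>s_eq\<close> to a neighbourhood of
      \<open>q\<close>, as the comparison of derivatives requires.\<close>
    have "\<forall>\<^sub>F x in nhds (snd c q). (q, chart_inv c x) \<in> U"
      by (rule has_mderiv_eventually_mem[OF has_mderiv_Pair[OF has_mderiv_const[OF chQ(1,1,2,2)]
              has_mderiv_ident[OF chQ]] pre_atlas_prod[OF pQ pQ] opU diag prod_chart_in_charts_at[OF c c]])
    then have "\<forall>\<^sub>F x in nhds (snd c q). l (a (chart_inv c x)) (s (chart_inv c x)) = chart_inv c x"
      by eventually_elim (rule s_eq)
    from has_mderiv_unique[OF has_mderiv_cong[OF prod this] has_mderiv_ident[OF chQ]]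
    have split: "O' (Da x) + Ds x = x" for x
      by metis
    define x where "x = snd v c"
    have vx: "tvec AQ q c x = v"
      using tvec_coord[OF sQ c vq] by (simp add: x_def)
    note add = linear_add[OF bounded_linear.linear[OF bounded_linear_connection_coord[OF G sQ A q c d]]]
    have "snd (\<A> v) d = snd (\<A> (tvec AQ q c (O' (Da x) + Ds x))) d"
      by (simp add: split vx)
    also have "\<dots> = snd (\<A> (tvec AQ q c (O' (Da x)))) d + snd (\<A> (tvec AQ q c (Ds x))) d"
      by (rule add)
    \<comment> \<open>\<A> returns \<open>Da x\<close> on the orbit direction
      \<open>O' (Da x)\<close> and vanishes on \<open>Ds x\<close>, which is a value of
      \<open>H\<close>.\<close>
    also have "\<dots> = Da x"
      by (simp add: connection_coord_orbit[OF PB A q c d orb] H(3) Ds_def)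
    also have "\<dots> = snd (tmap AQ AG a v) d"
      using tmap_coord[OF sQ Da c _ vq] d aq by (simp add: x_def)
    finally show ?thesis
      by simp
  qed
  have Av: "\<A> v \<in> tspace AG \<one>\<^bsub>G\<^esub>"
    by (rule connection_form_mem[OF G sQ A v])
  have "tmap AQ AG a v = \<A> v"
  proof (rule prod_eqI)
    show "fst (tmap AQ AG a v) = fst (\<A> v)"
      using tspace_fst[OF Av] aq by (simp add: tmap_def flip: q_def)
    show "snd (tmap AQ AG a v) = snd (\<A> v)"
    \<comment> \<open>In charts that do not contain the unit both families are 0, by the
      normalisation of tangent vectors.\<close>
    proof
      fix d
      show "snd (tmap AQ AG a v) d = snd (\<A> v) d"
        using coord[of d] tspace_off_charts[OF Av, of d] aq
        by (cases "d \<in> charts_at AG \<one>\<^bsub>G\<^esub>") (simp_all add: tmap_def flip: q_def)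
    qed
  qed
  then show "derived_connection AG AQ \<A>\<^sub>d v = \<A> v"
    by (simp add: derived_connection_def a_def[abs_def] q_def)
qed

end
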